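(* Let $\mathfrak{g}$ be a Kac--Moody algebra, $\lambda\in\mathfrak{h}^*$, let $V$ be any highest weight $\mathfrak{g}$-module with highest weight $\lambda$, and let $J\subseteq\mathcal{I}$. Then $$\mathrm{wt}\,V \;=\; \mathrm{wt}_{J_\lambda}V\;-\;\mathbb{Z}_{\geq 0}\big(\Delta^+\setminus\Delta^+_{J_\lambda}\big).$$ Moreover, $$\mathrm{wt}_J V-\mathbb{Z}_{\geq 0}\Pi_{J^c}\subseteq \mathrm{wt}\,V\quad\Longleftrightarrow\quad \mathrm{wt}\,V=\mathrm{wt}_J V-\mathbb{Z}_{\geq 0}\big(\Delta^+\setminus\Delta_J^+\big).$$
   Context: $\mathfrak{g}=\mathfrak{g}(A)$ is the complex Kac--Moody Lie algebra of a generalized Cartan matrix $A$ (not necessarily symmetrizable) with finite index set $\mathcal{I}$ (the nodes of the Dynkin diagram), with Cartan subalgebra $\mathfrak{h}$, simple roots $\alpha_i$ and simple co-roots $\alpha_i^\vee$ ($i\in\mathcal{I}$), root system $\Delta$ and positive roots $\Delta^+$. A highest weight module $V$ is always assumed nonzero (a nonzero quotient of the Verma module $M(\lambda)$). $\mathrm{wt}\,V=\{\mu\in\mathfrak{h}^*: V_\mu\neq 0\}$ is the set of weights, $V_\mu$ being the $\mu$-weight space. $J_\lambda=\{i\in\mathcal{I}:\lambda(\alpha_i^\vee)\in\mathbb{Z}_{\geq0}\}$. For $J\subseteq\mathcal{I}$: $J^c=\mathcal{I}\setminus J$, $\Pi_J=\{\alpha_j: j\in J\}$, $\Delta_J^+=\Delta^+\cap\mathbb{Z}\Pi_J$,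 and $\mathrm{wt}_JV=\mathrm{wt}\,V\cap(\lambda-\mathbb{Z}_{\geq0}\Pi_J)$. For a set $S$, $\mathbb{Z}_{\geq0}S$ is the set of finite non-negative integer combinations of elements of $S$ (equal to $\{0\}$ if $S=\emptyset$), and $C-D=\{c-d: c\in C,\,d\in D\}$ (Minkowski difference). *)

theory Defs
  imports "HOL-Analysis.Analysis"
begin

section \<open>Complex vector spaces and complex Lie algebras\<close>

class complex_vector = ab_group_add +
  fixes scaleC :: "complex \<Rightarrow> 'a \<Rightarrow> 'a"  (infixr \<open>*\<^sub>C\<close> 75)
  assumes scaleC_add_right: "a *\<^sub>C (x + y) = a *\<^sub>C x + a *\<^sub>C y"
    and scaleC_add_left: "(a + b) *\<^sub>C x = a *\<^sub>C x + b *\<^sub>C x"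
    and scaleC_scaleC: "a *\<^sub>C b *\<^sub>C x = (a * b) *\<^sub>C x"
    and scaleC_one: "1 *\<^sub>C x = x"

global_interpretation complex_vector: vector_space "scaleC :: complex \<Rightarrow> 'a \<Rightarrow> 'a::complex_vector"
  by unfold_locales (simp_all add: scaleC_add_right scaleC_add_left scaleC_scaleC scaleC_one)

class complex_lie_algebra = complex_vector +
  fixes lie_bracket :: "'a \<Rightarrow> 'a \<Rightarrow> 'a"
  assumes lie_add_left: "lie_bracket (x + y) z = lie_bracket x z + lie_bracket y z"
    and lie_add_right: "lie_bracket x (y + z) = lie_bracket x y + lie_bracket x z"
    and lie_scale_left: "lie_bracket (a *\<^sub>C x) y = a *\<^sub>C lie_bracket x y"
    and lie_scale_right: "lie_bracket x (a *\<^sub>C y) = a *\<^sub>C lie_bracket x y"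
    and lie_self: "lie_bracket x x = 0"
    and lie_jacobi: "lie_bracket x (lie_bracket y z) + lie_bracket y (lie_bracket z x)
                       + lie_bracket z (lie_bracket x y) = 0"

definition dual_space :: "('h::complex_vector \<Rightarrow> complex) set" where
  "dual_space = {\<phi>. Vector_Spaces.linear scaleC (*) \<phi>}"


section \<open>Generalized Cartan matrices and realizations\<close>

definition generalized_cartan_matrix :: "('i::finite \<Rightarrow> 'i \<Rightarrow> int) \<Rightarrow> bool" where
  "generalized_cartan_matrix A \<longleftrightarrow>
     (\<forall>i. A i i = 2) \<and> (\<forall>i j. i \<noteq> j \<longrightarrow> A i j \<le> 0) \<and> (\<forall>i j. A i j = 0 \<longrightarrow> A j i = 0)"

text \<open>
  The Cartan subalgebra is the type \<open>'h\<close>. The last condition is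
  \<open>dim \<hh> = 2n - rank A\<close>; since \<open>rank A \<le> n\<close> it makes the dimension positive, so that
  \<open>'h\<close> is finite-dimensional (\<open>dim\<close> is \<open>0\<close> in infinite dimension).
\<close>

definition realization ::
    "('i::finite \<Rightarrow> 'i \<Rightarrow> int) \<Rightarrow> ('i \<Rightarrow> 'h::complex_vector) \<Rightarrow> ('i \<Rightarrow> 'h \<Rightarrow> complex) \<Rightarrow> bool" where
  "realization A coroot sroot \<longleftrightarrow>
     (\<forall>i. sroot i \<in> dual_space) \<and>
     (\<forall>c. (\<Sum>i\<in>UNIV. c i *\<^sub>C coroot i) = 0 \<longrightarrow> (\<forall>i. c i = 0)) \<and>
     (\<forall>c. (\<forall>h. (\<Sum>i\<in>UNIV. c i * sroot i h) = 0) \<longrightarrow> (\<forall>i. c i = 0)) \<and>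
     (\<forall>i j. sroot j (coroot i) = of_int (A i j)) \<and>
     complex_vector.dim (UNIV :: 'h set) + rank (\<chi> i j. of_int (A i j) :: complex^'i^'i)
       = 2 * CARD('i)"


section \<open>Kac--Moody algebras\<close>

text \<open>
  The auxiliary Lie algebra of a realization, presented by the generators \<open>e\<^sub>i\<close>, \<open>f\<^sub>i\<close> and the
  space \<open>\<hh>\<close> subject to Kac's relations, is the set of Lie words modulo the congruence \<open>km_rel\<close>
  below. The Kac--Moody algebra is its quotient by the greatest ideal meeting \<open>\<hh>\<close> trivially.
\<close>

datatype ('h, 'i) lie_word =
    Cartan 'h | E 'i | F 'i
  | Zero
  | Plus "('h, 'i) lie_word" "('h, 'i) lie_word"
  | Scale complex "('h, 'i) lie_word"
  | Bracket "('h, 'i) lie_word" "('h, 'i) lie_word"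

inductive km_rel ::
    "('i \<Rightarrow> 'h::complex_vector) \<Rightarrow> ('i \<Rightarrow> 'h \<Rightarrow> complex) \<Rightarrow>
     ('h, 'i) lie_word \<Rightarrow> ('h, 'i) lie_word \<Rightarrow> bool"
  for coroot :: "'i \<Rightarrow> 'h::complex_vector" and sroot :: "'i \<Rightarrow> 'h \<Rightarrow> complex"
where
  refl: "km_rel coroot sroot s s"
| sym: "km_rel coroot sroot s t \<Longrightarrow> km_rel coroot sroot t s"
| trans: "km_rel coroot sroot s t \<Longrightarrow> km_rel coroot sroot t u \<Longrightarrow> km_rel coroot sroot s u"
| Plus_cong: "km_rel coroot sroot s s' \<Longrightarrow> km_rel coroot sroot t t' \<Longrightarrow>
    km_rel coroot sroot (Plus s t) (Plus s' t')"
| Scale_cong: "km_rel coroot sroot s s' \<Longrightarrow> km_rel coroot sroot (Scale a s) (Scale a s')"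
| Bracket_cong: "km_rel coroot sroot s s' \<Longrightarrow> km_rel coroot sroot t t' \<Longrightarrow>
    km_rel coroot sroot (Bracket s t) (Bracket s' t')"

| Plus_assoc: "km_rel coroot sroot (Plus (Plus s t) u) (Plus s (Plus t u))"
| Plus_commute: "km_rel coroot sroot (Plus s t) (Plus t s)"
| Plus_Zero: "km_rel coroot sroot (Plus Zero s) s"
| Plus_inverse: "km_rel coroot sroot (Plus (Scale (-1) s) s) Zero"
| Scale_add_right: "km_rel coroot sroot (Scale a (Plus s t)) (Plus (Scale a s) (Scale a t))"
| Scale_add_left: "km_rel coroot sroot (Scale (a + b) s) (Plus (Scale a s) (Scale b s))"
| Scale_Scale: "km_rel coroot sroot (Scale a (Scale b s)) (Scale (a * b) s)"
| Scale_one: "km_rel coroot sroot (Scale 1 s) s"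

| Bracket_add_left: "km_rel coroot sroot
    (Bracket (Plus s t) u) (Plus (Bracket s u) (Bracket t u))"
| Bracket_add_right: "km_rel coroot sroot
    (Bracket s (Plus t u)) (Plus (Bracket s t) (Bracket s u))"
| Bracket_scale_left: "km_rel coroot sroot (Bracket (Scale a s) t) (Scale a (Bracket s t))"
| Bracket_scale_right: "km_rel coroot sroot (Bracket s (Scale a t)) (Scale a (Bracket s t))"
| Bracket_self: "km_rel coroot sroot (Bracket s s) Zero"
| Jacobi: "km_rel coroot sroot
    (Plus (Plus (Bracket s (Bracket t u)) (Bracket t (Bracket u s))) (Bracket u (Bracket s t))) Zero"

| Cartan_add: "km_rel coroot sroot (Cartan (h + k)) (Plus (Cartan h) (Cartan k))"
| Cartan_scale: "km_rel coroot sroot (Cartan (a *\<^sub>C h)) (Scale a (Cartan h))"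

| E_F_same: "km_rel coroot sroot (Bracket (E i) (F i)) (Cartan (coroot i))"
| E_F_diff: "i \<noteq> j \<Longrightarrow> km_rel coroot sroot (Bracket (E i) (F j)) Zero"
| Cartan_Cartan: "km_rel coroot sroot (Bracket (Cartan h) (Cartan k)) Zero"
| Cartan_E: "km_rel coroot sroot (Bracket (Cartan h) (E i)) (Scale (sroot i h) (E i))"
| Cartan_F: "km_rel coroot sroot (Bracket (Cartan h) (F i)) (Scale (- sroot i h) (F i))"

text \<open>Ideals of the auxiliary algebra, as sets of words closed under the congruence.\<close>

definition aux_ideal ::
    "('i \<Rightarrow> 'h::complex_vector) \<Rightarrow> ('i \<Rightarrow> 'h \<Rightarrow> complex) \<Rightarrow> ('h, 'i) lie_word set \<Rightarrow> bool" where
  "aux_ideal coroot sroot I \<longleftrightarrow>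
     (\<forall>s t. km_rel coroot sroot s t \<longrightarrow> s \<in> I \<longrightarrow> t \<in> I) \<and>
     Zero \<in> I \<and>
     (\<forall>s\<in>I. \<forall>t\<in>I. Plus s t \<in> I) \<and>
     (\<forall>a. \<forall>s\<in>I. Scale a s \<in> I) \<and>
     (\<forall>s. \<forall>t\<in>I. Bracket s t \<in> I)"

definition meets_cartan_trivially ::
    "('i \<Rightarrow> 'h::complex_vector) \<Rightarrow> ('i \<Rightarrow> 'h \<Rightarrow> complex) \<Rightarrow> ('h, 'i) lie_word set \<Rightarrow> bool" where
  "meets_cartan_trivially coroot sroot I \<longleftrightarrow>
     (\<forall>h. Cartan h \<in> I \<longrightarrow> km_rel coroot sroot (Cartan h) Zero)"

definition greatest_aux_ideal ::
    "('i \<Rightarrow> 'h::complex_vector) \<Rightarrow> ('i \<Rightarrow> 'h \<Rightarrow> complex) \<Rightarrow> ('h, 'i) lie_word set \<Rightarrow> bool" where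
  "greatest_aux_ideal coroot sroot I \<longleftrightarrow>
     aux_ideal coroot sroot I \<and> meets_cartan_trivially coroot sroot I \<and>
     (\<forall>I'. aux_ideal coroot sroot I' \<longrightarrow> meets_cartan_trivially coroot sroot I' \<longrightarrow> I' \<subseteq> I)"

primrec eval_word ::
    "('h \<Rightarrow> 'g::complex_lie_algebra) \<Rightarrow> ('i \<Rightarrow> 'g) \<Rightarrow> ('i \<Rightarrow> 'g) \<Rightarrow> ('h, 'i) lie_word \<Rightarrow> 'g" where
  "eval_word emb e f (Cartan h) = emb h"
| "eval_word emb e f (E i) = e i"
| "eval_word emb e f (F i) = f i"
| "eval_word emb e f Zero = 0"
| "eval_word emb e f (Plus s t) = eval_word emb e f s + eval_word emb e f t"
| "eval_word emb e f (Scale a s) = a *\<^sub>C eval_word emb e f s"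
| "eval_word emb e f (Bracket s t) = lie_bracket (eval_word emb e f s) (eval_word emb e f t)"

text \<open>
  \<open>'g\<close> with the embedding \<open>emb\<close> of \<open>\<hh>\<close> and the Chevalley generators \<open>e\<close>, \<open>f\<close> is \<open>\<gg>(A)\<close>:
  evaluation of words is onto and its kernel is the ideal that is factored out.
\<close>

definition kac_moody_algebra ::
    "('i::finite \<Rightarrow> 'i \<Rightarrow> int) \<Rightarrow> ('i \<Rightarrow> 'h::complex_vector) \<Rightarrow> ('i \<Rightarrow> 'h \<Rightarrow> complex) \<Rightarrow>
     ('h \<Rightarrow> 'g::complex_lie_algebra) \<Rightarrow> ('i \<Rightarrow> 'g) \<Rightarrow> ('i \<Rightarrow> 'g) \<Rightarrow> bool" where
  "kac_moody_algebra A coroot sroot emb e f \<longleftrightarrow>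
     generalized_cartan_matrix A \<and> realization A coroot sroot \<and>
     surj (eval_word emb e f) \<and>
     greatest_aux_ideal coroot sroot {t. eval_word emb e f t = 0}"


section \<open>Roots\<close>

definition nat_span :: "('h \<Rightarrow> complex) set \<Rightarrow> ('h \<Rightarrow> complex) set" where
  "nat_span S = {\<lambda>h. \<Sum>\<phi>\<in>T. of_nat (n \<phi>) * \<phi> h | T n. finite T \<and> T \<subseteq> S}"

definition int_span :: "('h \<Rightarrow> complex) set \<Rightarrow> ('h \<Rightarrow> complex) set" where
  "int_span S = {\<lambda>h. \<Sum>\<phi>\<in>T. of_int (n \<phi>) * \<phi> h | T n. finite T \<and> T \<subseteq> S}"

definition minkowski_diff ::
    "('h \<Rightarrow> complex) set \<Rightarrow> ('h \<Rightarrow> complex) set \<Rightarrow> ('h \<Rightarrow> complex) set"  (infixl \<open>\<ominus>\<close> 65) where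
  "C \<ominus> D = {\<lambda>h. c h - d h | c d. c \<in> C \<and> d \<in> D}"

definition root_space ::
    "('h \<Rightarrow> 'g::complex_lie_algebra) \<Rightarrow> ('h \<Rightarrow> complex) \<Rightarrow> 'g set" where
  "root_space emb \<alpha> = {x. \<forall>h. lie_bracket (emb h) x = \<alpha> h *\<^sub>C x}"

definition roots :: "('h::complex_vector \<Rightarrow> 'g::complex_lie_algebra) \<Rightarrow> ('h \<Rightarrow> complex) set" where
  "roots emb = {\<alpha> \<in> dual_space. \<alpha> \<noteq> (\<lambda>h. 0) \<and> root_space emb \<alpha> \<noteq> {0}}"

definition pos_roots ::
    "('i \<Rightarrow> 'h \<Rightarrow> complex) \<Rightarrow> ('h::complex_vector \<Rightarrow> 'g::complex_lie_algebra) \<Rightarrow>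
     ('h \<Rightarrow> complex) set" where
  "pos_roots sroot emb = roots emb \<inter> nat_span (range sroot)"

definition pos_roots_sub ::
    "('i \<Rightarrow> 'h \<Rightarrow> complex) \<Rightarrow> ('h::complex_vector \<Rightarrow> 'g::complex_lie_algebra) \<Rightarrow> 'i set \<Rightarrow>
     ('h \<Rightarrow> complex) set" where
  "pos_roots_sub sroot emb J = pos_roots sroot emb \<inter> int_span (sroot ` J)"


section \<open>Highest weight modules and their weights\<close>

definition lie_module ::
    "('g::complex_lie_algebra \<Rightarrow> 'v::complex_vector \<Rightarrow> 'v) \<Rightarrow> bool" where
  "lie_module act \<longleftrightarrow>
     (\<forall>x. Vector_Spaces.linear scaleC scaleC (act x)) \<and>
     (\<forall>v. Vector_Spaces.linear scaleC scaleC (\<lambda>x. act x v)) \<and>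
     (\<forall>x y v. act (lie_bracket x y) v = act x (act y v) - act y (act x v))"

definition submodule ::
    "('g::complex_lie_algebra \<Rightarrow> 'v::complex_vector \<Rightarrow> 'v) \<Rightarrow> 'v set \<Rightarrow> bool" where
  "submodule act W \<longleftrightarrow> complex_vector.subspace W \<and> (\<forall>x. \<forall>w\<in>W. act x w \<in> W)"

definition lie_subalgebra :: "'g::complex_lie_algebra set \<Rightarrow> bool" where
  "lie_subalgebra L \<longleftrightarrow> complex_vector.subspace L \<and> (\<forall>x\<in>L. \<forall>y\<in>L. lie_bracket x y \<in> L)"

definition n_plus :: "('i \<Rightarrow> 'g::complex_lie_algebra) \<Rightarrow> 'g set" where
  "n_plus e = \<Inter> {L. lie_subalgebra L \<and> range e \<subseteq> L}"

text \<open>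
  Nonzero quotients of the Verma module \<open>M(\<Lambda>)\<close>: modules generated by a nonzero vector that is
  killed by \<open>\<nn>\<^sup>+\<close> and on which \<open>\<hh>\<close> acts through \<open>\<Lambda>\<close>.
\<close>

definition highest_weight_module ::
    "('h::complex_vector \<Rightarrow> 'g::complex_lie_algebra) \<Rightarrow> ('i \<Rightarrow> 'g) \<Rightarrow>
     ('g \<Rightarrow> 'v::complex_vector \<Rightarrow> 'v) \<Rightarrow> ('h \<Rightarrow> complex) \<Rightarrow> bool" where
  "highest_weight_module emb e act \<Lambda> \<longleftrightarrow>
     \<Lambda> \<in> dual_space \<and> lie_module act \<and>
     (\<exists>v. v \<noteq> 0 \<and> (\<forall>x\<in>n_plus e. act x v = 0) \<and> (\<forall>h. act (emb h) v = \<Lambda> h *\<^sub>C v) \<and>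
          (\<forall>W. submodule act W \<longrightarrow> v \<in> W \<longrightarrow> W = UNIV))"

definition weight_space ::
    "('h \<Rightarrow> 'g) \<Rightarrow> ('g \<Rightarrow> 'v::complex_vector \<Rightarrow> 'v) \<Rightarrow> ('h \<Rightarrow> complex) \<Rightarrow> 'v set" where
  "weight_space emb act \<mu> = {v. \<forall>h. act (emb h) v = \<mu> h *\<^sub>C v}"

definition wt ::
    "('h::complex_vector \<Rightarrow> 'g) \<Rightarrow> ('g \<Rightarrow> 'v::complex_vector \<Rightarrow> 'v) \<Rightarrow> ('h \<Rightarrow> complex) set" where
  "wt emb act = {\<mu> \<in> dual_space. weight_space emb act \<mu> \<noteq> {0}}"

definition wt_sub ::
    "('i \<Rightarrow> 'h \<Rightarrow> complex) \<Rightarrow> ('h::complex_vector \<Rightarrow> 'g) \<Rightarrow> ('g \<Rightarrow> 'v::complex_vector \<Rightarrow> 'v) \<Rightarrow>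
     ('h \<Rightarrow> complex) \<Rightarrow> 'i set \<Rightarrow> ('h \<Rightarrow> complex) set" where
  "wt_sub sroot emb act \<Lambda> J = wt emb act \<inter> ({\<Lambda>} \<ominus> nat_span (sroot ` J))"

definition J_set :: "('i \<Rightarrow> 'h) \<Rightarrow> ('h \<Rightarrow> complex) \<Rightarrow> 'i set" where
  "J_set coroot \<Lambda> = {i. \<Lambda> (coroot i) \<in> \<nat>}"

end

theory Submission
  imports Defs
begin

text \<open>
  Write \<open>Q\<close> for the root lattice. Every weight of the module is \<open>\<Lambda> - c\<close> with \<open>c \<in> Q\<close> non-negative, so
  the theorem is about a set of lattice points \<open>c\<close> (the predicate \<open>has_weight\<close>); \<open>c\<close> is stored as an
  integer vector, its multidegree, which is legitimate because the simple roots are independent.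

  Upper bound (\<open>wt_subset\<close>), valid for every \<open>J\<close>: the module is spanned by vectors
  \<open>y\<^sub>1 \<dots> y\<^sub>k f\<^bsub>j1\<^esub> \<dots> f\<^bsub>jm\<^esub> v\<close> with all \<open>j\<close>'s in \<open>J\<close> and all \<open>y\<close>'s brackets of \<open>f\<close>'s that involve a node
  outside \<open>J\<close>: moving a further \<open>f\<^sub>i\<close> with \<open>i \<in> J\<close> past a \<open>y\<close> only produces another such bracket. A
  nonzero \<open>y\<close> has as weight the negative of a positive root outside \<open>\<Delta>\<^sub>J\<close>; the Chevalley involution
  turns the negative root into a positive one.

  Lower bound (\<open>wt_superset\<close>): suppose that subtracting simple roots outside \<open>J\<close> from weights of
  \<open>wt\<^sub>J\<close> never leaves the set of weights. The positive part of the algebra is spanned by the brackets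
  that involve \<open>J\<close> only and by iterated brackets of elements in which exactly one letter lies outside
  \<open>J\<close> (\<open>brackets_level_decomposition\<close>). Hence each root outside \<open>\<Delta>\<^sub>J\<close> is a sum of roots whose height
  outside \<open>J\<close> is one, and it suffices to show that \<open>\<nu> = \<mu> - \<Sum> \<gamma>\<^sub>t\<close> is a weight when \<open>\<mu> \<in> wt\<^sub>J\<close> and the
  \<open>\<gamma>\<^sub>t\<close> are such roots (\<open>weights_minus_level_one\<close>). This is an induction on the total height of the
  \<open>\<gamma>\<^sub>t\<close>. If all are simple, it is the hypothesis. Otherwise some \<open>\<gamma>\<^sub>t - \<alpha>\<^sub>j\<close> with \<open>j \<in> J\<close> is again a root
  of this kind. If \<open>\<mu> - \<alpha>\<^sub>j\<close> is a weight, it takes the place of \<open>\<mu>\<close>. If not, \<open>\<mu>\<close> is a lowest weight for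
  the copy of sl2 at \<open>j\<close>; so \<open>\<langle>\<mu>, \<alpha>\<^sub>j\<^sup>\<or>\<rangle> = -m\<close> with \<open>m \<ge> 0\<close>, and \<open>\<mu> + m\<alpha>\<^sub>j\<close> is a weight. Reflecting \<open>\<mu>\<close>, and
  every \<open>\<gamma>\<^sub>t\<close> that pairs positively with the coroot
  (or, if none does, removing \<open>\<alpha>\<^sub>j\<close> from one of them), gives by induction a weight \<open>\<nu> + l\<alpha>\<^sub>j\<close> high enough on
  the string through \<open>\<nu>\<close> for sl2 theory to bring it down to \<open>\<nu>\<close>. That the reflected
  \<open>\<gamma>\<^sub>t\<close> is a root rests on the Serre relations, which in turn come from the fact that the algebra has
  no nonzero ideal meeting the Cartan subalgebra trivially.

  For \<open>J = J\<^sub>\<Lambda>\<close> the hypothesis of the lower bound holds (\<open>has_weight_outside_J_set\<close>): with \<open>i \<notin> J\<^sub>\<Lambda>\<close> the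
  vectors \<open>f\<^sub>i\<^sup>n v\<close> are nonzero, and since \<open>e\<^sub>i\<close> commutes with every other \<open>f\<^sub>k\<close>, applying \<open>e\<^sub>i\<^sup>n\<close> shows
  that \<open>f\<^sub>i\<^sup>n\<close> may be inserted next to \<open>v\<close> in any nonzero monomial that does not contain \<open>f\<^sub>i\<close>.
\<close>

section \<open>Representations of Lie algebras\<close>

lemma linear_scaleC_iff:
  "Vector_Spaces.linear scaleC scaleC (T :: 'a::complex_vector \<Rightarrow> 'b::complex_vector) \<longleftrightarrow>
     (\<forall>x y. T (x + y) = T x + T y) \<and> (\<forall>a x. T (a *\<^sub>C x) = a *\<^sub>C T x)"
  by (auto simp: Vector_Spaces.linear_iff complex_vector.vector_space_axioms)

lemma dual_space_iff:
  "\<phi> \<in> dual_space \<longleftrightarrow> (\<forall>x y. \<phi> (x + y) = \<phi> x + \<phi> y) \<and> (\<forall>a x. \<phi> (a *\<^sub>C x) = a * \<phi> x)"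
proof -
  have "vector_space ((*) :: complex \<Rightarrow> complex \<Rightarrow> complex)"
    by unfold_locales (auto simp: algebra_simps)
  then show ?thesis
    by (auto simp: dual_space_def Vector_Spaces.linear_iff complex_vector.vector_space_axioms)
qed

lemma lie_bracket_zero [simp]:
  "lie_bracket 0 (x :: 'g::complex_lie_algebra) = 0" "lie_bracket x 0 = 0"
  using lie_scale_left[of 0 0 x] lie_scale_right[of x 0 0] by simp_all

lemma lie_bracket_minus [simp]:
  "lie_bracket (- x) (y :: 'g::complex_lie_algebra) = - lie_bracket x y"
  "lie_bracket x (- y) = - lie_bracket x y"
  using lie_scale_left[of "-1" x y] lie_scale_right[of x "-1" y] by simp_all

lemma lie_antisym: "lie_bracket x y = - lie_bracket y (x :: 'g::complex_lie_algebra)"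
proof -
  have "0 = lie_bracket (x + y) (x + y)" by (rule lie_self[symmetric])
  also have "\<dots> = lie_bracket x y + lie_bracket y x"
    unfolding lie_add_left lie_add_right by (simp add: lie_self)
  finally show ?thesis by (simp add: eq_neg_iff_add_eq_0)
qed

lemma lie_derivation:
  "lie_bracket x (lie_bracket y z) =
     lie_bracket (lie_bracket x y) z + lie_bracket y (lie_bracket x (z :: 'g::complex_lie_algebra))"
proof -
  have "lie_bracket y (lie_bracket z x) = - lie_bracket y (lie_bracket x z)"
    using lie_antisym[of z x] by simp
  moreover have "lie_bracket z (lie_bracket x y) = - lie_bracket (lie_bracket x y) z"
    by (rule lie_antisym)
  ultimately show ?thesis
    using lie_jacobi[of x y z] by (simp add: algebra_simps)
qed

locale lie_representation =
  fixes act :: "'g::complex_lie_algebra \<Rightarrow> 'v::complex_vector \<Rightarrow> 'v"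
  assumes lie_module: "lie_module act"
begin

lemma act_add_right: "act x (v + w) = act x v + act x w"
  and act_scale_right: "act x (a *\<^sub>C v) = a *\<^sub>C act x v"
  and act_add_left: "act (x + y) v = act x v + act y v"
  and act_scale_left: "act (a *\<^sub>C x) v = a *\<^sub>C act x v"
  and act_bracket: "act (lie_bracket x y) v = act x (act y v) - act y (act x v)"
  using lie_module by (auto simp: lie_module_def linear_scaleC_iff)

lemma act_zero [simp]: "act x 0 = 0" "act 0 v = 0"
  using act_scale_right[of x 0 0] act_scale_left[of 0 0 v] by simp_all

lemma act_minus [simp]: "act x (- v) = - act x v" "act (- x) v = - act x v"
  using act_scale_right[of x "-1" v] act_scale_left[of "-1" x v] by simp_all

lemma act_commute: "act x (act y v) = act (lie_bracket x y) v + act y (act x v)"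
  by (simp add: act_bracket)

lemma funpow_act_zero [simp]: "(act x ^^ n) 0 = 0"
  by (induction n) simp_all

lemma funpow_act_scale: "(act x ^^ n) (a *\<^sub>C v) = a *\<^sub>C (act x ^^ n) v"
  by (induction n) (simp_all add: act_scale_right)

lemma act_span:
  assumes "v \<in> complex_vector.span B"
    and "\<And>b. b \<in> B \<Longrightarrow> act x b \<in> S" and "complex_vector.subspace S"
  shows "act x v \<in> S"
  using assms(1)
proof (induction rule: complex_vector.span_induct_alt)
  case base
  then show ?case using assms(3) by (simp add: complex_vector.subspace_0)
next
  case (step c b w)
  then show ?case
    using assms(2,3) by (simp add: act_add_right act_scale_right
        complex_vector.subspace_add complex_vector.subspace_scale)
qed

end

lemma lie_representation_adjoint: "lie_representation lie_bracket"
proof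
  have "lie_bracket (lie_bracket x y) v = lie_bracket x (lie_bracket y v) - lie_bracket y (lie_bracket x v)"
    for x y v :: 'a
    using lie_derivation[of x y v] by (simp add: eq_diff_eq)
  then show "lie_module (lie_bracket :: 'a \<Rightarrow> 'a \<Rightarrow> 'a)"
    by (simp add: lie_module_def linear_scaleC_iff lie_add_left lie_add_right lie_scale_left
      lie_scale_right)
qed

interpretation adjoint: lie_representation "lie_bracket :: 'g::complex_lie_algebra \<Rightarrow> 'g \<Rightarrow> 'g"
  by (rule lie_representation_adjoint)

section \<open>The algebra sl2\<close>

definition sl2_triple :: "'g::complex_lie_algebra \<Rightarrow> 'g \<Rightarrow> 'g \<Rightarrow> bool" where
  "sl2_triple x h y \<longleftrightarrow> lie_bracket x y = h \<and> lie_bracket h x = 2 *\<^sub>C x \<and> lie_bracket h y = (-2) *\<^sub>C y"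

lemma sl2_triple_swap: "sl2_triple x h y \<Longrightarrow> sl2_triple y (- h) x"
  using lie_antisym[of y x] by (auto simp: sl2_triple_def)

context lie_representation
begin

lemma sl2_weight_lower:
  assumes "sl2_triple x h y" "act h v = c *\<^sub>C v"
  shows "act h ((act y ^^ n) v) = (c - 2 * of_nat n) *\<^sub>C (act y ^^ n) v"
proof (induction n)
  case 0
  then show ?case using assms by simp
next
  case (Suc n)
  have "act h (act y ((act y ^^ n) v)) = act ((-2) *\<^sub>C y) ((act y ^^ n) v) + act y (act h ((act y ^^ n) v))"
    using assms by (subst act_commute) (simp add: sl2_triple_def)
  also have "\<dots> = (c - 2 * of_nat (Suc n)) *\<^sub>C act y ((act y ^^ n) v)"
    unfolding Suc act_scale_left act_scale_right
    by (simp add: algebra_simps flip: complex_vector.scale_left_distrib)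
  finally show ?case by simp
qed

text \<open>
  Each commutation of \<open>x\<close> past one of the factors \<open>y\<close> contributes the eigenvalue of \<open>h\<close> at that place;
  the coefficient is the sum of \<open>c, c - 2, \<dots>, c - 2n\<close>.
\<close>

lemma sl2_raise_lowered:
  assumes "sl2_triple x h y" "act h v = c *\<^sub>C v" "act x v = 0"
  shows "act x ((act y ^^ Suc n) v) = (of_nat (Suc n) * (c - of_nat n)) *\<^sub>C (act y ^^ n) v"
proof (induction n)
  case 0
  then show ?case using assms act_commute[of x y v] by (simp add: sl2_triple_def)
next
  case (Suc n)
  have "act x (act y ((act y ^^ Suc n) v)) = act h ((act y ^^ Suc n) v) + act y (act x ((act y ^^ Suc n) v))"
    using assms by (subst act_commute) (simp add: sl2_triple_def)
  also have "\<dots> = (c - 2 * of_nat (Suc n)) *\<^sub>C (act y ^^ Suc n) v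
      + (of_nat (Suc n) * (c - of_nat n)) *\<^sub>C (act y ^^ Suc n) v"
    unfolding Suc sl2_weight_lower[OF assms(1,2)] act_scale_right by simp
  also have "\<dots> = (of_nat (Suc (Suc n)) * (c - of_nat (Suc n))) *\<^sub>C (act y ^^ Suc n) v"
    unfolding complex_vector.scale_left_distrib[symmetric]
    by (rule arg_cong[where f = "\<lambda>a. a *\<^sub>C _"]) (simp add: algebra_simps)
  finally show ?case by simp
qed

lemma sl2_raise_lowered_power:
  assumes "sl2_triple x h y" "act h v = c *\<^sub>C v" "act x v = 0"
    and "\<And>k. k < n \<Longrightarrow> c \<noteq> of_nat k"
  shows "\<exists>a. a \<noteq> 0 \<and> (act x ^^ n) ((act y ^^ n) v) = a *\<^sub>C v"
  using assms(4)
proof (induction n)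
  case 0
  show ?case by (auto intro!: exI[of _ 1])
next
  case (Suc n)
  then obtain a where a: "a \<noteq> 0" "(act x ^^ n) ((act y ^^ n) v) = a *\<^sub>C v" by force
  have "(act x ^^ Suc n) ((act y ^^ Suc n) v) = (act x ^^ n) (act x ((act y ^^ Suc n) v))"
    by (simp add: funpow_swap1)
  also have "\<dots> = (of_nat (Suc n) * (c - of_nat n) * a) *\<^sub>C v"
    unfolding sl2_raise_lowered[OF assms(1-3)] funpow_act_scale a(2) by simp
  finally show ?case
    using a(1) Suc.prems[of n] by (intro exI[of _ "of_nat (Suc n) * (c - of_nat n) * a"]) (auto simp del: of_nat_Suc)
qed

lemma sl2_lowered_nonzero:
  assumes "sl2_triple x h y" "act h v = c *\<^sub>C v" "act x v = 0" "v \<noteq> 0"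
    and "\<And>k. k < n \<Longrightarrow> c \<noteq> of_nat k"
  shows "(act y ^^ n) v \<noteq> 0"
  using sl2_raise_lowered_power[OF assms(1-3), of n] assms(4,5) by fastforce

lemma last_nonzero_power:
  assumes "v \<noteq> 0" "(act x ^^ N) v = 0"
  obtains k where "(act x ^^ k) v \<noteq> 0" "act x ((act x ^^ k) v) = 0"
proof -
  define m where "m = (LEAST n. (act x ^^ n) v = 0)"
  have m: "(act x ^^ m) v = 0" unfolding m_def using assms(2) by (rule LeastI)
  then obtain k where k: "m = Suc k" using assms(1) by (cases m) auto
  have "(act x ^^ k) v \<noteq> 0" using not_less_Least[of k "\<lambda>n. (act x ^^ n) v = 0"] k m_def by auto
  then show thesis using that[of k] m k by simp
qed

text \<open>
  Climbing with \<open>x\<close> until the next step gives zero produces a highest weight vector of weight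
  \<open>p + 2k\<close>, which \<open>p + 2k\<close> applications of \<open>y\<close> do not kill. The vector obtained need not be a
  multiple of \<open>y\<^sup>l v\<close>, which may vanish.
\<close>

lemma sl2_string_down:
  assumes "sl2_triple x h y" "act h v = of_int p *\<^sub>C v" "v \<noteq> 0"
    and "(act x ^^ N) v = 0" and "int l \<le> p"
  shows "\<exists>k. (act y ^^ (k + l)) ((act x ^^ k) v) \<noteq> 0"
proof -
  obtain k where k: "(act x ^^ k) v \<noteq> 0" "act x ((act x ^^ k) v) = 0"
    using last_nonzero_power assms(3,4) by blast
  have "act (- h) v = of_int (- p) *\<^sub>C v" using assms(2) by simp
  from sl2_weight_lower[OF sl2_triple_swap[OF assms(1)] this, of k]
  have "act h ((act x ^^ k) v) = - ((of_int (- p) - 2 * of_nat k) *\<^sub>C (act x ^^ k) v)"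
    by (metis act_minus(2) minus_minus)
  then have w: "act h ((act x ^^ k) v) = of_int (p + 2 * int k) *\<^sub>C (act x ^^ k) v"
    by (simp flip: complex_vector.scale_minus_left)
  have "(act y ^^ (k + l)) ((act x ^^ k) v) \<noteq> 0"
  proof (rule sl2_lowered_nonzero[OF assms(1) w k(2,1)])
    fix j assume "j < k + l"
    then have "p + 2 * int k \<noteq> int j" using assms(5) by linarith
    then show "of_int (p + 2 * int k) \<noteq> (of_nat j :: complex)"
      by (metis of_int_eq_iff of_int_of_nat_eq)
  qed
  then show ?thesis ..
qed

text \<open>
  The string generated upwards from a lowest weight vector stops only where the coefficient of
  \<open>sl2_raise_lowered\<close>, with the roles of \<open>x\<close> and \<open>y\<close> exchanged, vanishes; this makes the weight
  an integer.
\<close>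

lemma sl2_lowest_weight:
  assumes "sl2_triple x h y" "act h v = c *\<^sub>C v" "v \<noteq> 0" "act y v = 0" "(act x ^^ N) v = 0"
  shows "\<exists>m. c = - of_nat m \<and> (\<forall>a\<le>m. (act x ^^ a) v \<noteq> 0)"
proof -
  obtain m where m: "(act x ^^ m) v \<noteq> 0" "act x ((act x ^^ m) v) = 0"
    using last_nonzero_power assms(3,5) by blast
  have "act (- h) v = (- c) *\<^sub>C v" using assms(2) by simp
  from sl2_raise_lowered[OF sl2_triple_swap[OF assms(1)] this assms(4), of m] m
  have "of_nat (Suc m) * (- c - of_nat m) = (0::complex)" by simp
  then have "- c - of_nat m = 0" by (simp del: of_nat_Suc)
  then have c: "c = - of_nat m" by (metis diff_eq_eq add_0 minus_minus)
  have "(act x ^^ a) v \<noteq> 0" if "a \<le> m" for a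
  proof
    assume "(act x ^^ a) v = 0"
    then have "(act x ^^ (m - a)) ((act x ^^ a) v) = 0" by simp
    then show False using m(1) that by (simp flip: funpow_add[THEN fun_cong, unfolded o_apply])
  qed
  with c show ?thesis by blast
qed

end

section \<open>Weight vectors\<close>

lemma weight_spaceD: "x \<in> weight_space emb act \<mu> \<Longrightarrow> act (emb h) x = \<mu> h *\<^sub>C x"
  by (simp add: weight_space_def)

lemma root_space_eq: "root_space emb \<alpha> = weight_space emb lie_bracket \<alpha>"
  by (simp add: root_space_def weight_space_def)

context lie_representation
begin

lemma zero_in_weight_space [simp]: "0 \<in> weight_space emb act \<mu>"
  by (simp add: weight_space_def)

lemma weight_space_add:
  "x \<in> weight_space emb act \<mu> \<Longrightarrow> y \<in> weight_space emb act \<mu> \<Longrightarrow> x + y \<in> weight_space emb act \<mu>"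
  by (simp add: weight_space_def act_add_right complex_vector.scale_right_distrib)

lemma weight_space_scale:
  "x \<in> weight_space emb act \<mu> \<Longrightarrow> a *\<^sub>C x \<in> weight_space emb act \<mu>"
  by (simp add: weight_space_def act_scale_right mult.commute)

lemma weight_space_act:
  assumes "y \<in> weight_space emb lie_bracket \<alpha>" "x \<in> weight_space emb act \<mu>"
  shows "act y x \<in> weight_space emb act (\<lambda>h. \<alpha> h + \<mu> h)"
  unfolding weight_space_def
proof (clarify)
  fix h
  show "act (emb h) (act y x) = (\<alpha> h + \<mu> h) *\<^sub>C act y x"
    using assms by (subst act_commute)
      (simp add: weight_space_def act_scale_left act_scale_right complex_vector.scale_left_distrib)
qed

lemma weight_unique:
  assumes "x \<in> weight_space emb act \<mu>" "x \<in> weight_space emb act \<nu>" "x \<noteq> 0"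
  shows "\<mu> = \<nu>"
proof
  fix h
  have "\<mu> h *\<^sub>C x = \<nu> h *\<^sub>C x" using assms by (metis weight_spaceD)
  then show "\<mu> h = \<nu> h" using assms(3) by simp
qed

lemma act_sum: "act x (sum u M) = (\<Sum>\<mu>\<in>M. act x (u \<mu>))"
  by (induction M rule: infinite_finite_induct) (simp_all add: act_add_right)

text \<open>
  Applying \<open>emb h - \<mu>\<^sub>0 h\<close> to a vanishing sum removes the component of weight \<open>\<mu>\<^sub>0\<close> and rescales the
  others.
\<close>

lemma weight_vectors_independent:
  assumes "finite M" "\<And>\<mu>. \<mu> \<in> M \<Longrightarrow> u \<mu> \<in> weight_space emb act \<mu>" "(\<Sum>\<mu>\<in>M. u \<mu>) = 0"
  shows "\<forall>\<mu>\<in>M. u \<mu> = 0"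
  using assms
proof (induction M arbitrary: u rule: finite_induct)
  case empty
  then show ?case by simp
next
  case (insert \<mu>0 M)
  have IH: "\<forall>\<mu>\<in>M. (\<mu> h - \<mu>0 h) *\<^sub>C u \<mu> = 0" for h
  proof (rule insert.IH)
    have "0 = act (emb h) (\<Sum>\<mu>\<in>insert \<mu>0 M. u \<mu>) - \<mu>0 h *\<^sub>C (\<Sum>\<mu>\<in>insert \<mu>0 M. u \<mu>)"
      using insert.prems by simp
    also have "\<dots> = (\<Sum>\<mu>\<in>insert \<mu>0 M. \<mu> h *\<^sub>C u \<mu>) - (\<Sum>\<mu>\<in>insert \<mu>0 M. \<mu>0 h *\<^sub>C u \<mu>)"
      unfolding act_sum complex_vector.scale_sum_right using insert.prems(1)
      by (intro arg_cong2[where f = minus] sum.cong) (auto simp: weight_spaceD)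
    also have "\<dots> = (\<Sum>\<mu>\<in>M. (\<mu> h - \<mu>0 h) *\<^sub>C u \<mu>)"
      using insert.hyps by (simp add: complex_vector.scale_left_diff_distrib sum_subtractf)
    finally show "(\<Sum>\<mu>\<in>M. (\<mu> h - \<mu>0 h) *\<^sub>C u \<mu>) = 0" by simp
  qed (use insert.prems in \<open>auto intro: weight_space_scale\<close>)
  have 1: "u \<mu> = 0" if "\<mu> \<in> M" for \<mu>
  proof -
    have "\<mu> \<noteq> \<mu>0" using that insert.hyps by auto
    then obtain h where "\<mu> h \<noteq> \<mu>0 h" by auto
    then show ?thesis using IH[of h, rule_format, OF that] by simp
  qed
  then show ?case using insert.prems(2) insert.hyps by simp
qed

text \<open>
  This is how weights are read off a spanning set: no weights occur except those of its nonzero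
  members.
\<close>

lemma weight_vector_in_span:
  assumes "x \<in> complex_vector.span B" "x \<in> weight_space emb act \<mu>" "x \<noteq> 0"
    and "\<And>b. b \<in> B \<Longrightarrow> \<exists>\<nu>. b \<in> weight_space emb act \<nu>"
  shows "\<exists>b\<in>B. b \<noteq> 0 \<and> b \<in> weight_space emb act \<mu>"
proof (rule ccontr)
  assume neg: "\<not> ?thesis"
  have "\<exists>M u. finite M \<and> \<mu> \<notin> M \<and> (\<forall>\<nu>. u \<nu> \<in> weight_space emb act \<nu>) \<and>
      (\<forall>\<nu>. \<nu> \<notin> M \<longrightarrow> u \<nu> = 0) \<and> x = (\<Sum>\<nu>\<in>M. u \<nu>)"
    using assms(1)
  proof (induction rule: complex_vector.span_induct_alt)
    case base
    show ?case by (intro exI[of _ "{}"] exI[of _ "\<lambda>_. 0"]) simp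
  next
    case (step c b y)
    then obtain M u where M: "finite M" "\<mu> \<notin> M" "\<And>\<nu>. u \<nu> \<in> weight_space emb act \<nu>"
      "\<And>\<nu>. \<nu> \<notin> M \<Longrightarrow> u \<nu> = 0" "y = (\<Sum>\<nu>\<in>M. u \<nu>)" by blast
    obtain \<nu>0 where \<nu>0: "b \<in> weight_space emb act \<nu>0" using assms(4) step by blast
    show ?case
    proof (cases "b = 0")
      case True
      then show ?thesis using M by auto
    next
      case False
      then have "\<nu>0 \<noteq> \<mu>" using neg step \<nu>0 by blast
      define u' where "u' = u(\<nu>0 := c *\<^sub>C b + u \<nu>0)"
      have "(\<Sum>\<nu>\<in>insert \<nu>0 M. u' \<nu>) = u' \<nu>0 + (\<Sum>\<nu>\<in>M - {\<nu>0}. u' \<nu>)"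
        using M(1) by (simp add: sum.insert_remove)
      also have "(\<Sum>\<nu>\<in>M - {\<nu>0}. u' \<nu>) = (\<Sum>\<nu>\<in>M - {\<nu>0}. u \<nu>)"
        by (rule sum.cong) (auto simp: u'_def)
      also have "u' \<nu>0 + \<dots> = c *\<^sub>C b + (u \<nu>0 + (\<Sum>\<nu>\<in>M - {\<nu>0}. u \<nu>))"
        by (simp add: u'_def add.assoc)
      also have "u \<nu>0 + (\<Sum>\<nu>\<in>M - {\<nu>0}. u \<nu>) = y"
      proof (cases "\<nu>0 \<in> M")
        case True
        then show ?thesis using M(1,5) by (simp add: sum.remove)
      next
        case False
        then show ?thesis using M(4,5) by simp
      qed
      finally have "c *\<^sub>C b + y = (\<Sum>\<nu>\<in>insert \<nu>0 M. u' \<nu>)" by simp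
      moreover have "\<forall>\<nu>. u' \<nu> \<in> weight_space emb act \<nu>"
        using M(3) \<nu>0 by (auto simp: u'_def intro!: weight_space_add weight_space_scale)
      moreover have "\<forall>\<nu>. \<nu> \<notin> insert \<nu>0 M \<longrightarrow> u' \<nu> = 0" using M(4) by (auto simp: u'_def)
      moreover have "finite (insert \<nu>0 M)" "\<mu> \<notin> insert \<nu>0 M" using M(1,2) \<open>\<nu>0 \<noteq> \<mu>\<close> by auto
      ultimately show ?thesis by blast
    qed
  qed
  then obtain M u where M: "finite M" "\<mu> \<notin> M" "\<And>\<nu>. u \<nu> \<in> weight_space emb act \<nu>"
    "x = (\<Sum>\<nu>\<in>M. u \<nu>)" by blast
  define u' where "u' = u(\<mu> := - x)"
  have "(\<Sum>\<nu>\<in>M. u' \<nu>) = (\<Sum>\<nu>\<in>M. u \<nu>)"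
    using M(2) by (intro sum.cong) (auto simp: u'_def)
  then have "(\<Sum>\<nu>\<in>insert \<mu> M. u' \<nu>) = 0" using M by (simp add: u'_def)
  moreover have "- x \<in> weight_space emb act \<mu>"
    using weight_space_scale[OF assms(2), of "-1"] by simp
  then have "u' \<nu> \<in> weight_space emb act \<nu>" for \<nu>
    using M(3) by (simp add: u'_def)
  ultimately have "u' \<mu> = 0"
    using weight_vectors_independent[of "insert \<mu> M" u' emb] M(1) by blast
  then show False using assms(3) by (simp add: u'_def)
qed

end

section \<open>Monomials in the generators and their multidegrees\<close>

definition monomial :: "('g \<Rightarrow> 'v \<Rightarrow> 'v) \<Rightarrow> ('i \<Rightarrow> 'g) \<Rightarrow> 'i list \<Rightarrow> 'v \<Rightarrow> 'v" where
  "monomial act x w v = foldr (\<lambda>i. act (x i)) w v"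

lemma monomial_simps [simp]:
  "monomial act x [] v = v"
  "monomial act x (i # w) v = act (x i) (monomial act x w v)"
  "monomial act x (u @ w) v = monomial act x u (monomial act x w v)"
  by (simp_all add: monomial_def)

lemma monomial_replicate: "monomial act x (replicate n i) v = (act (x i) ^^ n) v"
  by (induction n) simp_all

primrec multidegree :: "'i list \<Rightarrow> int^'i" where
  "multidegree [] = 0"
| "multidegree (i # w) = axis i 1 + multidegree w"

lemma multidegree_append: "multidegree (u @ w) = multidegree u + multidegree w"
  by (induction u) simp_all

lemma multidegree_nonneg: "multidegree w $ i \<ge> 0"
  by (induction w) (simp_all add: axis_def)

lemma multidegree_eq_0_iff: "multidegree w $ i = 0 \<longleftrightarrow> i \<notin> set w"
proof (induction w)
  case (Cons j w)
  have "multidegree w $ i \<ge> 0" by (rule multidegree_nonneg)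
  then show ?case using Cons by (auto simp: axis_def)
qed simp

lemma multidegree_replicate: "multidegree (replicate n i) = axis i (int n)"
  by (induction n) (simp_all add: vec_eq_iff axis_def)

definition root_of :: "('i::finite \<Rightarrow> 'h \<Rightarrow> complex) \<Rightarrow> int^'i \<Rightarrow> 'h \<Rightarrow> complex" where
  "root_of sroot c h = (\<Sum>i\<in>UNIV. of_int (c $ i) * sroot i h)"

lemma root_of_add [simp]: "root_of sroot (c + d) h = root_of sroot c h + root_of sroot d h"
  and root_of_diff [simp]: "root_of sroot (c - d) h = root_of sroot c h - root_of sroot d h"
  and root_of_minus [simp]: "root_of sroot (- c) h = - root_of sroot c h"
  and root_of_zero [simp]: "root_of sroot 0 h = 0"
  by (simp_all add: root_of_def algebra_simps sum.distrib sum_subtractf sum_negf)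

lemma root_of_axis [simp]: "root_of sroot (axis i a) h = of_int a * sroot i h"
proof -
  have "root_of sroot (axis i a) h = (\<Sum>j\<in>UNIV. if j = i then of_int a * sroot i h else 0)"
    unfolding root_of_def by (rule sum.cong) (auto simp: axis_def)
  then show ?thesis by simp
qed

section \<open>Lie algebras with Chevalley generators\<close>

text \<open>
  Right-normed brackets are the monomials of the adjoint representation applied to a generator.
\<close>

definition brackets :: "('i \<Rightarrow> 'g::complex_lie_algebra) \<Rightarrow> 'g set" where
  "brackets x = {monomial lie_bracket x w (x i) | w i. True}"

lemma monomial_in_brackets: "monomial lie_bracket x w (x i) \<in> brackets x"
  unfolding brackets_def by blast

lemma brackets_generator: "x i \<in> brackets x"
  unfolding brackets_def by (rule CollectI, rule exI[of _ "[]"]) auto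

lemma brackets_bracket: "b \<in> brackets x \<Longrightarrow> lie_bracket (x i) b \<in> brackets x"
  unfolding brackets_def by (clarify, rule_tac x = "i # w" in exI) auto

text \<open>
  The relations, and the fact that \<open>e\<close>, \<open>f\<close> and the Cartan part generate, are kept apart from the
  maximality of the ideal that is factored out because of their symmetry: exchanging \<open>e\<close> and \<open>f\<close> and
  changing the sign of the Cartan part gives the same relations (lemma \<open>swapped\<close>), so statements
  about one half of the algebra transfer to the other.
\<close>

locale chevalley_generators =
  fixes coroot :: "'i::finite \<Rightarrow> 'h::complex_vector"
    and sroot :: "'i \<Rightarrow> 'h \<Rightarrow> complex"
    and emb :: "'h \<Rightarrow> 'g::complex_lie_algebra"
    and e f :: "'i \<Rightarrow> 'g"
  assumes emb_add: "emb (h + k) = emb h + emb k"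
    and emb_scale: "emb (a *\<^sub>C h) = a *\<^sub>C emb h"
    and e_f_same: "lie_bracket (e i) (f i) = emb (coroot i)"
    and e_f_diff: "i \<noteq> j \<Longrightarrow> lie_bracket (e i) (f j) = 0"
    and cartan_cartan: "lie_bracket (emb h) (emb k) = 0"
    and cartan_e: "lie_bracket (emb h) (e i) = sroot i h *\<^sub>C e i"
    and cartan_f: "lie_bracket (emb h) (f i) = (- sroot i h) *\<^sub>C f i"
    and generated: "lie_subalgebra L \<Longrightarrow> range emb \<subseteq> L \<Longrightarrow> range e \<subseteq> L \<Longrightarrow> range f \<subseteq> L \<Longrightarrow> L = UNIV"
begin

lemma emb_zero [simp]: "emb 0 = 0"
  using emb_scale[of 0 0] by simp

lemma emb_minus [simp]: "emb (- h) = - emb h"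
  using emb_scale[of "-1" h] by simp

lemma swapped: "chevalley_generators coroot sroot (\<lambda>h. - emb h) f e"
proof
  fix i j :: 'i
  show "lie_bracket (f i) (e i) = - emb (coroot i)"
    using lie_antisym[of "f i" "e i"] e_f_same by simp
  show "lie_bracket (f i) (e j) = 0" if "i \<noteq> j"
    using lie_antisym[of "f i" "e j"] e_f_diff that by simp
next
  fix L :: "'g set"
  assume L: "lie_subalgebra L" "range (\<lambda>h. - emb h) \<subseteq> L" "range f \<subseteq> L" "range e \<subseteq> L"
  have "emb h \<in> L" for h
    using subsetD[OF L(2) rangeI[of _ "- h"]] by simp
  then show "L = UNIV" using generated L by blast
qed (simp_all add: emb_add emb_scale cartan_cartan cartan_e cartan_f)

lemma e_weight: "e i \<in> weight_space emb lie_bracket (sroot i)"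
  and f_weight: "f i \<in> weight_space emb lie_bracket (\<lambda>h. - sroot i h)"
  and emb_weight: "emb h \<in> weight_space emb lie_bracket (\<lambda>h. 0)"
  by (simp_all add: weight_space_def cartan_e cartan_f cartan_cartan)

text \<open>
  The elements that preserve a subspace form a subalgebra, so it is enough to test generators.
\<close>

lemma stable_under_generators:
  assumes "lie_representation act" "complex_vector.subspace S"
    and "\<And>h s. s \<in> S \<Longrightarrow> act (emb h) s \<in> S"
    and "\<And>i s. s \<in> S \<Longrightarrow> act (e i) s \<in> S" and "\<And>i s. s \<in> S \<Longrightarrow> act (f i) s \<in> S"
    and "s \<in> S"
  shows "act x s \<in> S"
proof -
  interpret lie_representation act by fact
  have "{y. \<forall>s\<in>S. act y s \<in> S} = UNIV"
  proof (rule generated)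
    show "lie_subalgebra {y. \<forall>s\<in>S. act y s \<in> S}"
      unfolding lie_subalgebra_def complex_vector.subspace_def
      using assms(2) by (auto simp: act_add_left act_scale_left act_bracket complex_vector.subspace_add
          complex_vector.subspace_scale complex_vector.subspace_0 complex_vector.subspace_diff)
  qed (use assms in auto)
  then show ?thesis using assms(6) by blast
qed

lemma monomial_weight:
  assumes "lie_representation act" "v \<in> weight_space emb act \<mu>"
  shows monomial_e_weight:
      "monomial act e w v \<in> weight_space emb act (\<lambda>h. \<mu> h + root_of sroot (multidegree w) h)"
    and monomial_f_weight:
      "monomial act f w v \<in> weight_space emb act (\<lambda>h. \<mu> h - root_of sroot (multidegree w) h)"
proof -
  interpret lie_representation act by fact
  show "monomial act e w v \<in> weight_space emb act (\<lambda>h. \<mu> h + root_of sroot (multidegree w) h)"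
  proof (induction w)
    case (Cons i w)
    show ?case using weight_space_act[OF e_weight[of i] Cons] by (simp add: algebra_simps)
  qed (use assms in simp)
  show "monomial act f w v \<in> weight_space emb act (\<lambda>h. \<mu> h - root_of sroot (multidegree w) h)"
  proof (induction w)
    case (Cons i w)
    show ?case using weight_space_act[OF f_weight[of i] Cons] by (simp add: algebra_simps)
  qed (use assms in simp)
qed

lemma bracket_e_weight:
  "monomial lie_bracket e w (e i) \<in> weight_space emb lie_bracket (root_of sroot (multidegree w + axis i 1))"
  using monomial_e_weight[OF lie_representation_adjoint e_weight, where i1 = i and w = w]
  by (simp add: weight_space_def add.commute)

lemma bracket_f_weight:
  "monomial lie_bracket f w (f i)
     \<in> weight_space emb lie_bracket (\<lambda>h. - root_of sroot (multidegree w + axis i 1) h)"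
  using monomial_f_weight[OF lie_representation_adjoint f_weight, where i1 = i and w = w]
  by (simp add: algebra_simps)

lemma coroot_weight:
  assumes "lie_representation act" "v \<in> weight_space emb act \<mu>"
  shows "act (lie_bracket (e i) (f j)) v = (if i = j then \<mu> (coroot i) else 0) *\<^sub>C v"
proof -
  interpret lie_representation act by fact
  show ?thesis using assms(2) by (auto simp: e_f_same e_f_diff weight_spaceD)
qed

lemma raise_brackets_f:
  assumes "b \<in> brackets f"
  shows "lie_bracket (e i) b \<in> complex_vector.span (range emb \<union> brackets f)"
proof -
  obtain w k where b: "b = monomial lie_bracket f w (f k)" using assms by (auto simp: brackets_def)
  show ?thesis unfolding b
  proof (induction w)
    case Nil
    show ?case
      by (cases "i = k") (auto simp: e_f_same e_f_diff complex_vector.span_zero intro: complex_vector.span_base)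
  next
    case (Cons j w)
    let ?X = "monomial lie_bracket f w (f k)" and ?S = "complex_vector.span (range emb \<union> brackets f)"
    have X: "?X \<in> brackets f" by (auto simp: brackets_def)
    have "lie_bracket (lie_bracket (e i) (f j)) ?X \<in> ?S"
      unfolding coroot_weight[OF lie_representation_adjoint bracket_f_weight]
      using X by (auto intro: complex_vector.span_scale complex_vector.span_base complex_vector.span_zero)
    moreover have "lie_bracket (f j) (lie_bracket (e i) ?X) \<in> ?S"
    proof (rule adjoint.act_span[OF Cons.IH])
      fix y assume "y \<in> range emb \<union> brackets f"
      then show "lie_bracket (f j) y \<in> ?S"
      proof
        assume "y \<in> range emb"
        then obtain h where "y = emb h" by auto
        then have "lie_bracket (f j) y = sroot j h *\<^sub>C f j"
          using lie_antisym[of "f j" y] cartan_f[of h j] by simp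
        then show ?thesis
          using brackets_generator[of f j] by (auto intro: complex_vector.span_scale complex_vector.span_base)
      qed (auto intro: complex_vector.span_base brackets_bracket)
    qed simp
    ultimately show ?case
      by (simp add: lie_derivation[of "e i"] complex_vector.span_add)
  qed
qed

lemma range_emb_swapped: "range (\<lambda>h. - emb h) = range emb"
proof -
  have "- emb h \<in> range emb" "emb h \<in> range (\<lambda>h. - emb h)" for h
    using rangeI[of emb "- h"] rangeI[of "\<lambda>h. - emb h" "- h"] by simp_all
  then show ?thesis by blast
qed

lemma lower_brackets_e:
  assumes "b \<in> brackets e"
  shows "lie_bracket (f i) b \<in> complex_vector.span (range emb \<union> brackets e)"
proof -
  interpret swap: chevalley_generators coroot sroot "\<lambda>h. - emb h" f e by (rule swapped)
  show ?thesis using swap.raise_brackets_f[OF assms] by (simp only: range_emb_swapped)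
qed

text \<open>
  The span is stable under the generators, hence an ideal; being an ideal that contains the
  generators, it is everything.
\<close>

theorem triangular_decomposition:
  "complex_vector.span (range emb \<union> brackets e \<union> brackets f) = UNIV" (is "?S = UNIV")
proof -
  have base: "b \<in> ?S" if "b \<in> range emb \<union> brackets e \<union> brackets f" for b
    using that by (rule complex_vector.span_base)
  have gen: "emb h \<in> ?S" "e i \<in> ?S" "f i \<in> ?S" for h i
    by (auto intro!: base brackets_generator)
  have e_emb: "lie_bracket (e i) (emb h) \<in> ?S" "lie_bracket (f i) (emb h) \<in> ?S" for i h
    using lie_antisym[of "e i" "emb h"] lie_antisym[of "f i" "emb h"] gen
    by (auto simp: cartan_e cartan_f intro: complex_vector.span_scale complex_vector.span_neg)
  have mono: "complex_vector.span (range emb \<union> brackets f) \<subseteq> ?S"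
    "complex_vector.span (range emb \<union> brackets e) \<subseteq> ?S"
    by (rule complex_vector.span_mono; blast)+
  have stable: "lie_bracket x s \<in> ?S" if "s \<in> ?S" for x s
  proof (rule stable_under_generators[OF lie_representation_adjoint _ _ _ _ that])
    fix i s assume s: "s \<in> ?S"
    show "lie_bracket (e i) s \<in> ?S"
      by (rule adjoint.act_span[OF s])
        (use e_emb raise_brackets_f mono in \<open>auto intro: base brackets_bracket\<close>)
    show "lie_bracket (f i) s \<in> ?S"
      by (rule adjoint.act_span[OF s])
        (use e_emb lower_brackets_e mono in \<open>auto intro: base brackets_bracket\<close>)
  next
    fix h s assume s: "s \<in> ?S"
    have "lie_bracket (emb h) b \<in> ?S" if b: "b \<in> range emb \<union> brackets e \<union> brackets f" for b
    proof -
      have "\<exists>\<mu>. b \<in> weight_space emb lie_bracket \<mu>"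
        using b emb_weight bracket_e_weight bracket_f_weight by (force simp: brackets_def)
      then show ?thesis
        using base[OF b] by (auto simp: weight_spaceD intro: complex_vector.span_scale)
    qed
    then show "lie_bracket (emb h) s \<in> ?S" using adjoint.act_span[OF s] by auto
  qed simp
  show ?thesis
  proof (rule generated)
    show "lie_subalgebra ?S" using stable by (auto simp: lie_subalgebra_def)
  qed (use gen in auto)
qed

end

section \<open>The simple root vectors are nonzero\<close>

text \<open>
  In the Kac--Moody algebra \<open>[e\<^sub>i, f\<^sub>i]\<close> is the image of the coroot, so \<open>e\<^sub>i \<noteq> 0\<close> if that
  image is nonzero. The ideal that is factored out meets the Cartan subalgebra trivially, so it suffices
  that the coroot is nonzero in the auxiliary algebra. The latter acts on the tensor algebra of a space
  with basis indexed by the nodes: \<open>F i\<close> is left multiplication by the basis vector of \<open>i\<close>, the word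
  \<open>u\<close> has weight \<open>\<nu> - \<Sum>\<^bsub>k \<in> u\<^esub> \<alpha>\<^sub>k\<close>, and \<open>E i\<close> deletes one letter \<open>i\<close>, with the coefficient that the
  relation \<open>[E i, F j] = \<delta>\<^bsub>ij\<^esub> \<alpha>\<^sub>i\<^sup>\<or>\<close> forces. An element \<open>a\<close> of the completed tensor algebra is given by its
  coefficients \<open>a u\<close>; the coefficient of \<open>u\<close> in \<open>E i a\<close> is therefore a sum over the insertions of \<open>i\<close>
  into \<open>u\<close>.
\<close>

definition tensor_weight :: "('i \<Rightarrow> 'h \<Rightarrow> complex) \<Rightarrow> ('h \<Rightarrow> complex) \<Rightarrow> 'i list \<Rightarrow> 'h \<Rightarrow> complex" where
  "tensor_weight sroot \<nu> u h = \<nu> h - (\<Sum>k\<leftarrow>u. sroot k h)"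

lemma tensor_weight_simps [simp]:
  "tensor_weight sroot \<nu> [] h = \<nu> h"
  "tensor_weight sroot \<nu> (k # u) h = tensor_weight sroot \<nu> u h - sroot k h"
  by (simp_all add: tensor_weight_def)

primrec tensor_raise ::
    "('i \<Rightarrow> 'h) \<Rightarrow> ('i \<Rightarrow> 'h \<Rightarrow> complex) \<Rightarrow> ('h \<Rightarrow> complex) \<Rightarrow> 'i \<Rightarrow> 'i list \<Rightarrow> ('i list \<Rightarrow> complex) \<Rightarrow> complex" where
  "tensor_raise coroot sroot \<nu> i [] a = tensor_weight sroot \<nu> [] (coroot i) * a [i]"
| "tensor_raise coroot sroot \<nu> i (k # u) a =
     tensor_weight sroot \<nu> (k # u) (coroot i) * a (i # k # u)
     + tensor_raise coroot sroot \<nu> i u (\<lambda>w. a (k # w))"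

primrec tensor_lower :: "'i \<Rightarrow> 'i list \<Rightarrow> ('i list \<Rightarrow> complex) \<Rightarrow> complex" where
  "tensor_lower i [] a = 0"
| "tensor_lower i (k # u) a = (if k = i then a u else 0)"

primrec tensor_rep ::
    "('i \<Rightarrow> 'h) \<Rightarrow> ('i \<Rightarrow> 'h \<Rightarrow> complex) \<Rightarrow> ('h \<Rightarrow> complex) \<Rightarrow> ('h, 'i) lie_word \<Rightarrow>
     ('i list \<Rightarrow> complex) \<Rightarrow> 'i list \<Rightarrow> complex" where
  "tensor_rep coroot sroot \<nu> (Cartan h) a = (\<lambda>u. tensor_weight sroot \<nu> u h * a u)"
| "tensor_rep coroot sroot \<nu> (E i) a = (\<lambda>u. tensor_raise coroot sroot \<nu> i u a)"
| "tensor_rep coroot sroot \<nu> (F i) a = (\<lambda>u. tensor_lower i u a)"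
| "tensor_rep coroot sroot \<nu> Zero a = (\<lambda>u. 0)"
| "tensor_rep coroot sroot \<nu> (Plus s t) a =
     (\<lambda>u. tensor_rep coroot sroot \<nu> s a u + tensor_rep coroot sroot \<nu> t a u)"
| "tensor_rep coroot sroot \<nu> (Scale c s) a = (\<lambda>u. c * tensor_rep coroot sroot \<nu> s a u)"
| "tensor_rep coroot sroot \<nu> (Bracket s t) a =
     (\<lambda>u. tensor_rep coroot sroot \<nu> s (tensor_rep coroot sroot \<nu> t a) u
        - tensor_rep coroot sroot \<nu> t (tensor_rep coroot sroot \<nu> s a) u)"

lemma tensor_raise_linear:
  "tensor_raise coroot sroot \<nu> i u (\<lambda>w. c * a w + d * b w) =
     c * tensor_raise coroot sroot \<nu> i u a + d * tensor_raise coroot sroot \<nu> i u b"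
  by (induction u arbitrary: a b) (simp_all add: algebra_simps)

text \<open>
  The bilinearity relations for brackets hold in this model only because all operators are linear.
\<close>

lemma tensor_rep_linear:
  "tensor_rep coroot sroot \<nu> t (\<lambda>w. c * a w + d * b w) u =
     c * tensor_rep coroot sroot \<nu> t a u + d * tensor_rep coroot sroot \<nu> t b u"
proof (induction t arbitrary: a b u c d)
  case (F i)
  show ?case by (cases u) simp_all
next
  case (Bracket s t)
  show ?case by (simp add: Bracket[abs_def] algebra_simps)
qed (simp_all add: tensor_raise_linear algebra_simps)

lemma tensor_rep_additive:
  "tensor_rep coroot sroot \<nu> t (\<lambda>w. a w + b w) u =
     tensor_rep coroot sroot \<nu> t a u + tensor_rep coroot sroot \<nu> t b u"
  "tensor_rep coroot sroot \<nu> t (\<lambda>w. a w - b w) u =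
     tensor_rep coroot sroot \<nu> t a u - tensor_rep coroot sroot \<nu> t b u"
  "tensor_rep coroot sroot \<nu> t (\<lambda>w. c * a w) u = c * tensor_rep coroot sroot \<nu> t a u"
  "tensor_rep coroot sroot \<nu> t (\<lambda>w. 0) u = 0"
  using tensor_rep_linear[of coroot sroot \<nu> t 1 a 1 b u] tensor_rep_linear[of coroot sroot \<nu> t 1 a "-1" b u]
    tensor_rep_linear[of coroot sroot \<nu> t c a 0 b u] tensor_rep_linear[of coroot sroot \<nu> t 0 a 0 b u]
  by simp_all

text \<open>
  The shift \<open>c\<close> absorbs the weights of the letters in front of the place of insertion, which the
  recursion strips off. For \<open>c = 0\<close> this is the relation between the Cartan part and \<open>E i\<close>.
\<close>

lemma tensor_raise_weight:
  "tensor_raise coroot sroot \<nu> i u (\<lambda>w. (tensor_weight sroot \<nu> w h + c) * a w) =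
     (tensor_weight sroot \<nu> u h - sroot i h + c) * tensor_raise coroot sroot \<nu> i u a"
proof (induction u arbitrary: a c)
  case (Cons k u)
  have "(\<lambda>w. (tensor_weight sroot \<nu> (k # w) h + c) * a (k # w)) =
      (\<lambda>w. (tensor_weight sroot \<nu> w h + (c - sroot k h)) * a (k # w))"
    by (simp add: algebra_simps)
  then show ?case
    using Cons[of "c - sroot k h" "\<lambda>w. a (k # w)"] by (simp add: algebra_simps)
qed (simp add: algebra_simps)

lemma tensor_raise_lower:
  "tensor_raise coroot sroot \<nu> i u (\<lambda>w. tensor_lower j w a) =
     (if i = j then tensor_weight sroot \<nu> u (coroot i) * a u else 0)
     + tensor_lower j u (\<lambda>w. tensor_raise coroot sroot \<nu> i w a)"
proof (cases u)
  case (Cons k v)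
  have "tensor_raise coroot sroot \<nu> i v (\<lambda>w. 0) = 0"
    using tensor_raise_linear[of coroot sroot \<nu> i v 0 a 0 a] by simp
  then show ?thesis using Cons by auto
qed auto

lemma tensor_rep_respects:
  assumes "\<And>i. sroot i \<in> dual_space" "\<nu> \<in> dual_space" "km_rel coroot sroot s t"
  shows "tensor_rep coroot sroot \<nu> s a u = tensor_rep coroot sroot \<nu> t a u"
proof -
  have lin: "tensor_weight sroot \<nu> u (h + k) = tensor_weight sroot \<nu> u h + tensor_weight sroot \<nu> u k"
    "tensor_weight sroot \<nu> u (c *\<^sub>C h) = c * tensor_weight sroot \<nu> u h" for u h k c
    using assms(1,2) by (induction u) (auto simp: dual_space_iff algebra_simps)
  show ?thesis using assms(3)
  proof (induction arbitrary: a u rule: km_rel.induct)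
    case (Bracket_cong s s' t t')
    then have "tensor_rep coroot sroot \<nu> s = tensor_rep coroot sroot \<nu> s'"
      "tensor_rep coroot sroot \<nu> t = tensor_rep coroot sroot \<nu> t'"
      by (intro ext; simp)+
    then show ?case by simp
  next
    case (E_F_same i)
    show ?case using tensor_raise_lower[of coroot sroot \<nu> i u i a] by simp
  next
    case (E_F_diff i j)
    then show ?case using tensor_raise_lower[of coroot sroot \<nu> i u j a] by simp
  next
    case (Cartan_E h i)
    show ?case
      using tensor_raise_weight[of coroot sroot \<nu> i u h 0 a] by (simp add: algebra_simps)
  next
    case (Cartan_F h i)
    show ?case by (cases u) (auto simp: algebra_simps)
  qed (simp_all add: tensor_rep_additive lin algebra_simps)
qed

lemma cartan_nonzero_in_auxiliary_algebra:
  assumes "\<And>i. sroot i \<in> dual_space" "\<nu> \<in> dual_space" "\<nu> h \<noteq> 0"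
  shows "\<not> km_rel coroot sroot (Cartan h) Zero"
proof
  assume "km_rel coroot sroot (Cartan h) Zero"
  from tensor_rep_respects[OF assms(1,2) this, of "\<lambda>_. 1" "[]"] assms(3) show False by simp
qed

section \<open>Kac--Moody algebras\<close>

text \<open>
  Only the kernel of evaluation is known to be closed under the congruence; applied to differences of
  words, this gives that evaluation itself respects it.
\<close>

lemma kernel_eq_if_related:
  assumes "aux_ideal coroot sroot {t. eval_word emb e f t = (0::'g::complex_lie_algebra)}" 
    and "km_rel coroot sroot s t"
  shows "eval_word emb e f s = eval_word emb e f t"
proof -
  have "km_rel coroot sroot (Plus (Scale (-1) t) t) (Plus (Scale (-1) s) t)"
    using assms(2) by (intro km_rel.Plus_cong km_rel.Scale_cong km_rel.refl) (rule km_rel.sym)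
  then have "km_rel coroot sroot Zero (Plus (Scale (-1) s) t)"
    using km_rel.Plus_inverse km_rel.sym km_rel.trans by metis
  then have "eval_word emb e f (Plus (Scale (-1) s) t) = 0"
    using assms(1) unfolding aux_ideal_def by blast
  then show ?thesis by (simp add: neg_eq_iff_add_eq_0[symmetric])
qed

lemma (in chevalley_generators) eval_word_respects:
  assumes "km_rel coroot sroot s t"
  shows "eval_word emb e f s = eval_word emb e f t"
  using assms
proof (induction rule: km_rel.induct)
  case (Jacobi s t u)
  show ?case by (simp add: lie_jacobi)
qed (simp_all add: emb_add emb_scale e_f_same e_f_diff cartan_cartan cartan_e cartan_f
    lie_add_left lie_add_right lie_scale_left lie_scale_right lie_self
    complex_vector.scale_right_distrib complex_vector.scale_left_distrib add.commute add.left_commute)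

locale kac_moody =
  fixes A :: "'i::finite \<Rightarrow> 'i \<Rightarrow> int"
    and coroot :: "'i \<Rightarrow> 'h::complex_vector"
    and sroot :: "'i \<Rightarrow> 'h \<Rightarrow> complex"
    and emb :: "'h \<Rightarrow> 'g::complex_lie_algebra"
    and e f :: "'i \<Rightarrow> 'g"
  assumes kac_moody: "kac_moody_algebra A coroot sroot emb e f"
begin

lemma sroot_dual: "sroot i \<in> dual_space"
  and sroot_coroot: "sroot j (coroot i) = of_int (A i j)"
  and sroot_independent: "(\<And>h. (\<Sum>i\<in>UNIV. c i * sroot i h) = 0) \<Longrightarrow> c i = 0"
  and cartan_diag: "A i i = 2"
  and cartan_offdiag: "i \<noteq> j \<Longrightarrow> A i j \<le> 0"
  and cartan_zero: "A i j = 0 \<Longrightarrow> A j i = 0"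
  and kernel_ideal: "aux_ideal coroot sroot {t. eval_word emb e f t = 0}"
  and kernel_cartan: "meets_cartan_trivially coroot sroot {t. eval_word emb e f t = 0}"
  and kernel_greatest: "aux_ideal coroot sroot I \<Longrightarrow> meets_cartan_trivially coroot sroot I \<Longrightarrow>
    t \<in> I \<Longrightarrow> eval_word emb e f t = 0"
  and surj_eval: "surj (eval_word emb e f)"
proof -
  have gcm: "generalized_cartan_matrix A" and real: "realization A coroot sroot"
    and surj: "surj (eval_word emb e f)"
    and greatest: "greatest_aux_ideal coroot sroot {t. eval_word emb e f t = 0}"
    using kac_moody unfolding kac_moody_algebra_def by auto
  show "A i i = 2" "i \<noteq> j \<Longrightarrow> A i j \<le> 0" "A i j = 0 \<Longrightarrow> A j i = 0"
    using gcm unfolding generalized_cartan_matrix_def by auto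
  show "sroot i \<in> dual_space" "sroot j (coroot i) = of_int (A i j)"
    using real unfolding realization_def by auto
  have "\<forall>c. (\<forall>h. (\<Sum>i\<in>UNIV. c i * sroot i h) = 0) \<longrightarrow> (\<forall>i. c i = 0)"
    using real unfolding realization_def by (elim conjE) assumption
  then show "c i = 0" if "\<And>h. (\<Sum>i\<in>UNIV. c i * sroot i h) = 0"
    using that by blast
  show "surj (eval_word emb e f)" by (rule surj)
  show "aux_ideal coroot sroot {t. eval_word emb e f t = 0}"
    "meets_cartan_trivially coroot sroot {t. eval_word emb e f t = 0}"
    using greatest unfolding greatest_aux_ideal_def by auto
  show "eval_word emb e f t = 0"
    if "aux_ideal coroot sroot I" "meets_cartan_trivially coroot sroot I" "t \<in> I"
    using greatest that unfolding greatest_aux_ideal_def by blast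
qed

sublocale chevalley_generators coroot sroot emb e f
proof
  note eval = kernel_eq_if_related[OF kernel_ideal]
  fix h k a i j
  show "emb (h + k) = emb h + emb k" using eval[OF km_rel.Cartan_add] by simp
  show "emb (a *\<^sub>C h) = a *\<^sub>C emb h" using eval[OF km_rel.Cartan_scale] by simp
  show "lie_bracket (e i) (f i) = emb (coroot i)" using eval[OF km_rel.E_F_same] by simp
  show "lie_bracket (e i) (f j) = 0" if "i \<noteq> j" using eval[OF km_rel.E_F_diff[OF that]] by simp
  show "lie_bracket (emb h) (emb k) = 0" using eval[OF km_rel.Cartan_Cartan] by simp
  show "lie_bracket (emb h) (e i) = sroot i h *\<^sub>C e i" using eval[OF km_rel.Cartan_E] by simp
  show "lie_bracket (emb h) (f i) = (- sroot i h) *\<^sub>C f i" using eval[OF km_rel.Cartan_F] by simp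
next
  fix L :: "'g set"
  assume L: "lie_subalgebra L" "range emb \<subseteq> L" "range e \<subseteq> L" "range f \<subseteq> L"
  have "eval_word emb e f t \<in> L" for t
    using L by (induction t) (auto simp: lie_subalgebra_def complex_vector.subspace_def)
  then show "L = UNIV" using surj_eval by (metis UNIV_eq_I surjD)
qed

lemma e_nonzero: "e i \<noteq> 0"
proof
  assume "e i = 0"
  then have "emb (coroot i) = 0" using e_f_same[of i] by simp
  then have "km_rel coroot sroot (Cartan (coroot i)) Zero"
    using kernel_cartan by (simp add: meets_cartan_trivially_def)
  moreover have "sroot i (coroot i) \<noteq> 0" by (simp add: sroot_coroot cartan_diag)
  ultimately show False
    using cartan_nonzero_in_auxiliary_algebra[of sroot "sroot i"] sroot_dual by blast
qed

text \<open>
  The preimage of such an ideal consists of words that lie in the greatest ideal of its kind, that is,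
  in the kernel of evaluation.
\<close>

lemma ideal_meeting_cartan_trivially:
  assumes "complex_vector.subspace S" "\<And>x s. s \<in> S \<Longrightarrow> lie_bracket x s \<in> S"
    and "\<And>h. emb h \<in> S \<Longrightarrow> emb h = 0" and "s \<in> S"
  shows "s = 0"
proof -
  let ?I = "{t. eval_word emb e f t \<in> S}"
  have "aux_ideal coroot sroot ?I"
    unfolding aux_ideal_def using assms(1,2) eval_word_respects
    by (auto simp: complex_vector.subspace_def)
  moreover have "meets_cartan_trivially coroot sroot ?I"
    using kernel_cartan assms(3) by (simp add: meets_cartan_trivially_def)
  moreover obtain t where "s = eval_word emb e f t" using surj_eval by blast
  ultimately show ?thesis using kernel_greatest[of ?I t] assms(4) by blast
qed

text \<open>
  Evaluation at the swapped generators also has as kernel an ideal meeting the Cartan subalgebra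
  trivially, and the kernel of the original evaluation is the greatest one. This replaces the
  Chevalley involution as a map; it is enough to compare the two halves of the algebra.
\<close>

lemma chevalley_involution:
  assumes "eval_word (\<lambda>h. - emb h) f e t = 0"
  shows "eval_word emb e f t = 0"
proof -
  interpret swap: chevalley_generators coroot sroot "\<lambda>h. - emb h" f e by (rule swapped)
  let ?I = "{t. eval_word (\<lambda>h. - emb h) f e t = 0}"
  have "aux_ideal coroot sroot ?I"
    unfolding aux_ideal_def using swap.eval_word_respects by auto
  moreover have "meets_cartan_trivially coroot sroot ?I"
    using kernel_cartan by (simp add: meets_cartan_trivially_def)
  ultimately show ?thesis using kernel_greatest assms by blast
qed

lemma bracket_e_nonzero:
  assumes "monomial lie_bracket f w (f i) \<noteq> 0"
  shows "monomial lie_bracket e w (e i) \<noteq> 0"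
proof -
  let ?t = "foldr (\<lambda>j. Bracket (F j)) w (F i)"
  have "eval_word emb e f ?t = monomial lie_bracket f w (f i)"
    "eval_word (\<lambda>h. - emb h) f e ?t = monomial lie_bracket e w (e i)"
    by (induction w) simp_all
  then show ?thesis using chevalley_involution[of ?t] assms by metis
qed

lemma root_of_inj:
  assumes "root_of sroot c = root_of sroot d"
  shows "c = d"
proof -
  have "(of_int (c $ i - d $ i) :: complex) = 0" for i
  proof (rule sroot_independent[of "\<lambda>i. of_int (c $ i - d $ i)"])
    fix h
    have "root_of sroot (c - d) h = 0" using assms by simp
    then show "(\<Sum>i\<in>UNIV. of_int (c $ i - d $ i) * sroot i h) = 0" by (simp add: root_of_def)
  qed
  then show ?thesis by (simp add: vec_eq_iff)
qed

section \<open>The Serre relations and local nilpotency\<close>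

lemma sl2_triple_generators: "sl2_triple (e i) (emb (coroot i)) (f i)"
  by (simp add: sl2_triple_def e_f_same cartan_e cartan_f sroot_coroot cartan_diag)

lemma cartan_in_span_brackets_e:
  assumes "emb h \<in> complex_vector.span (brackets e)"
  shows "emb h = 0"
proof (rule ccontr)
  assume "emb h \<noteq> 0"
  then obtain b where b: "b \<in> brackets e" "b \<noteq> 0" "b \<in> weight_space emb lie_bracket (\<lambda>h. 0)"
    using adjoint.weight_vector_in_span[OF assms emb_weight] bracket_e_weight
    unfolding brackets_def by blast
  then obtain w i where "b = monomial lie_bracket e w (e i)" by (auto simp: brackets_def)
  then have "root_of sroot (multidegree w + axis i 1) = (\<lambda>h. 0)"
    using adjoint.weight_unique bracket_e_weight b by blast
  also have "\<dots> = root_of sroot 0" by auto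
  finally have "multidegree w + axis i 1 = 0" by (rule root_of_inj)
  then have "multidegree w $ i + 1 = 0" by (metis axis_nth vector_add_component zero_index)
  then show False using multidegree_nonneg[of w i] by simp
qed

text \<open>
  The ideal generated by such an \<open>x\<close> is spanned by the monomials \<open>e\<^bsub>i1\<^esub> \<dots> e\<^bsub>ik\<^esub> x\<close>, so it stays in the
  positive half, which meets the Cartan subalgebra trivially.
\<close>

lemma killed_by_lowering:
  assumes "x \<in> complex_vector.span (brackets e)" "x \<in> weight_space emb lie_bracket \<mu>"
    and "\<And>k. lie_bracket (f k) x = 0"
  shows "x = 0"
proof -
  let ?B = "{monomial lie_bracket e w x | w. True}"
  let ?S = "complex_vector.span ?B"
  have B: "monomial lie_bracket e w x \<in> ?S" for w
    by (rule complex_vector.span_base) auto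
  have lower: "lie_bracket (f k) (monomial lie_bracket e w x) \<in> ?S" for k w
  proof (induction w)
    case Nil
    show ?case using assms(3) by (simp add: complex_vector.span_zero)
  next
    case (Cons j w)
    let ?y = "monomial lie_bracket e w x"
    have "lie_bracket (lie_bracket (f k) (e j)) ?y = - lie_bracket (lie_bracket (e j) (f k)) ?y"
      using lie_antisym[of "f k" "e j"] by simp
    also have "\<dots> \<in> ?S"
      unfolding coroot_weight[OF lie_representation_adjoint monomial_e_weight[OF lie_representation_adjoint assms(2)]]
      using B by (intro complex_vector.span_neg complex_vector.span_scale)
    finally have "lie_bracket (lie_bracket (f k) (e j)) ?y \<in> ?S" .
    moreover have "lie_bracket (e j) (lie_bracket (f k) ?y) \<in> ?S"
    proof (rule adjoint.act_span[OF Cons])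
      fix b assume "b \<in> ?B"
      then obtain w where "b = monomial lie_bracket e w x" by blast
      then show "lie_bracket (e j) b \<in> ?S" using B[of "j # w"] by simp
    qed simp
    ultimately show ?case by (simp add: lie_derivation[of "f k"] complex_vector.span_add)
  qed
  have stable: "lie_bracket y s \<in> ?S" if "s \<in> ?S" for y s
  proof (rule stable_under_generators[OF lie_representation_adjoint _ _ _ _ that])
    fix i s assume s: "s \<in> ?S"
    show "lie_bracket (e i) s \<in> ?S"
      by (rule adjoint.act_span[OF s]) (use B[of "i # _"] in auto)
    show "lie_bracket (f i) s \<in> ?S"
      by (rule adjoint.act_span[OF s]) (use lower in auto)
  next
    fix h s assume s: "s \<in> ?S"
    show "lie_bracket (emb h) s \<in> ?S"
    proof (rule adjoint.act_span[OF s])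
      fix b assume "b \<in> ?B"
      then obtain w where w: "b = monomial lie_bracket e w x" by blast
      show "lie_bracket (emb h) b \<in> ?S"
        unfolding w weight_spaceD[OF monomial_e_weight[OF lie_representation_adjoint assms(2)]]
        using B by (intro complex_vector.span_scale)
    qed simp
  qed simp
  have "monomial lie_bracket e w x \<in> complex_vector.span (brackets e)" for w
  proof (induction w)
    case (Cons i w)
    show ?case unfolding monomial_simps
      by (rule adjoint.act_span[OF Cons]) (auto intro: complex_vector.span_base brackets_bracket)
  qed (use assms in simp)
  then have "?S \<subseteq> complex_vector.span (brackets e)"
    by (intro complex_vector.span_minimal) auto
  then show ?thesis
    using ideal_meeting_cartan_trivially[of ?S x] stable cartan_in_span_brackets_e B[of "[]"] by auto
qed

end

lemma (in lie_representation) act_funpow_commute: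
  assumes "lie_bracket x y = 0"
  shows "act x ((act y ^^ n) v) = (act y ^^ n) (act x v)"
  by (induction n) (simp_all add: act_commute[of x y] assms)

context kac_moody
begin

text \<open>
  The element is killed by every \<open>f\<^sub>k\<close>: by sl2 theory for \<open>k = j\<close>, where \<open>e\<^sub>i\<close> is a lowest weight vector;
  because \<open>f\<^sub>k\<close> commutes with \<open>e\<^sub>j\<close> for the other \<open>k\<close>.
\<close>

lemma serre_relation:
  assumes "i \<noteq> j"
  shows "(lie_bracket (e j) ^^ Suc (nat (- A j i))) (e i) = 0"
proof -
  define n where "n = nat (- A j i)"
  have n: "A j i = - int n" using cartan_offdiag[of j i] assms by (simp add: n_def)
  let ?x = "(lie_bracket (e j) ^^ Suc n) (e i)"
  have mon: "?x = monomial lie_bracket e (replicate (Suc n) j) (e i)"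
    by (simp only: monomial_replicate)
  have "?x = 0"
  proof (rule killed_by_lowering)
    show "?x \<in> complex_vector.span (brackets e)"
      unfolding mon by (rule complex_vector.span_base) (rule monomial_in_brackets)
    show "?x \<in> weight_space emb lie_bracket (root_of sroot (multidegree (replicate (Suc n) j) + axis i 1))"
      unfolding mon by (rule bracket_e_weight)
    fix k
    show "lie_bracket (f k) ?x = 0"
    proof (cases "k = j")
      case True
      have "lie_bracket (f j) (e i) = 0" using e_f_diff[OF assms] lie_antisym[of "f j" "e i"] by simp
      moreover have "lie_bracket (- emb (coroot j)) (e i) = of_nat n *\<^sub>C e i"
        by (simp add: cartan_e sroot_coroot n)
      ultimately show ?thesis
        using adjoint.sl2_raise_lowered[OF sl2_triple_swap[OF sl2_triple_generators], of j "e i" "of_nat n" n] True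
        by simp
    next
      case False
      have "lie_bracket (f k) (e j) = 0" using e_f_diff[of j k] lie_antisym[of "f k" "e j"] False by simp
      then have comm: "lie_bracket (f k) ?x = (lie_bracket (e j) ^^ Suc n) (lie_bracket (f k) (e i))"
        by (rule adjoint.act_funpow_commute)
      show ?thesis
      proof (cases "k = i")
        case ki: False
        then have "lie_bracket (f k) (e i) = 0" using e_f_diff[of i k] lie_antisym[of "f k" "e i"] by simp
        then show ?thesis using comm by simp
      next
        case True
        have "lie_bracket (e j) (lie_bracket (f k) (e i)) = of_int (A i j) *\<^sub>C e j"
          using lie_antisym[of "f i" "e i"] lie_antisym[of "e j" "emb (coroot i)"] True
          by (simp add: e_f_same cartan_e sroot_coroot)
        then have "lie_bracket (f k) ?x = (lie_bracket (e j) ^^ n) (of_int (A i j) *\<^sub>C e j)"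
          using comm by (simp add: funpow_swap1)
        also have "\<dots> = 0"
        proof (cases n)
          case 0
          \<comment> \<open>This is where a vanishing entry of the Cartan matrix must vanish symmetrically.\<close>
          then have "A i j = 0" using cartan_zero[of j i] n by simp
          then show ?thesis using 0 by simp
        next
          case (Suc m)
          then show ?thesis by (simp add: funpow_swap1 lie_scale_right lie_self)
        qed
        finally show ?thesis .
      qed
    qed
  qed
  then show ?thesis by (simp add: n_def)
qed

end

text \<open>
  By Leibniz, each term of the power applied to the bracket has at least \<open>m\<close> factors on \<open>y\<close> or at
  least \<open>n\<close> on \<open>z\<close>.
\<close>

lemma adjoint_power_bracket_zero:
  fixes x :: "'g::complex_lie_algebra"
  assumes "(lie_bracket x ^^ m) y = 0" "(lie_bracket x ^^ n) z = 0"
  shows "(lie_bracket x ^^ (m + n)) (lie_bracket y z) = 0"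
  using assms
proof (induction "m + n" arbitrary: m n y z)
  case 0
  then show ?case by simp
next
  case (Suc k)
  show ?case
  proof (cases "m = 0 \<or> n = 0")
    case True
    then have "lie_bracket y z = 0" using Suc.prems by auto
    then show ?thesis by simp
  next
    case False
    then obtain m' n' where mn: "m = Suc m'" "n = Suc n'" by (metis not0_implies_Suc)
    have add: "(lie_bracket x ^^ k) (v + w) = (lie_bracket x ^^ k) v + (lie_bracket x ^^ k) w" for v w
      by (induction k) (simp_all add: lie_add_right)
    have "(lie_bracket x ^^ (m' + n)) (lie_bracket (lie_bracket x y) z) = 0"
      using Suc mn by (intro Suc(1)) (simp_all add: funpow_swap1)
    moreover have "(lie_bracket x ^^ (m + n')) (lie_bracket y (lie_bracket x z)) = 0"
      using Suc mn by (intro Suc(1)) (simp_all add: funpow_swap1)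
    moreover have "m' + n = k" "m + n' = k" "m + n = Suc k" using Suc(2) mn by auto
    ultimately have "(lie_bracket x ^^ k) (lie_bracket x (lie_bracket y z)) = 0"
      by (simp add: lie_derivation[of x y z] add)
    then show ?thesis using \<open>m + n = Suc k\<close> by (simp add: funpow_swap1)
  qed
qed

lemma (in kac_moody) e_locally_nilpotent:
  "\<exists>N. (lie_bracket (e j) ^^ N) (monomial lie_bracket e w (e i)) = 0"
proof -
  have gen: "\<exists>N. (lie_bracket (e j) ^^ N) (e i) = 0" for i
  proof (cases "i = j")
    case True
    then show ?thesis by (intro exI[of _ 1]) (simp add: lie_self)
  qed (use serre_relation in blast)
  show ?thesis
  proof (induction w)
    case (Cons k w)
    then show ?case using gen[of k] adjoint_power_bracket_zero by fastforce
  qed (use gen in simp)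
qed

section \<open>Strings of weights\<close>

context kac_moody
begin

text \<open>
  The two lemmas restate the sl2 results on strings in terms of weights, in a form that serves the
  adjoint representation and highest weight modules alike.
\<close>

lemma weight_string_down:
  assumes "lie_representation act" "x \<in> weight_space emb act \<mu>" "x \<noteq> 0"
    and "\<mu> (coroot j) = of_int p" "(act (e j) ^^ N) x = 0" "int l \<le> p"
  shows "\<exists>y. y \<noteq> 0 \<and> y \<in> weight_space emb act (\<lambda>h. \<mu> h - of_nat l * sroot j h)"
proof -
  interpret lie_representation act by fact
  have "act (emb (coroot j)) x = of_int p *\<^sub>C x" using assms(2,4) by (simp add: weight_spaceD)
  from sl2_string_down[OF sl2_triple_generators this assms(3,5,6)]
  obtain k where k: "(act (f j) ^^ (k + l)) ((act (e j) ^^ k) x) \<noteq> 0" by blast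
  have "monomial act f (replicate (k + l) j) (monomial act e (replicate k j) x) \<in>
      weight_space emb act (\<lambda>h. \<mu> h + root_of sroot (multidegree (replicate k j)) h
        - root_of sroot (multidegree (replicate (k + l) j)) h)"
    using assms(1,2) by (intro monomial_f_weight monomial_e_weight)
  then have "(act (f j) ^^ (k + l)) ((act (e j) ^^ k) x) \<in>
      weight_space emb act (\<lambda>h. \<mu> h - of_nat l * sroot j h)"
    unfolding monomial_replicate multidegree_replicate by (simp add: algebra_simps)
  with k show ?thesis by blast
qed

lemma weight_string_up:
  assumes "lie_representation act" "x \<in> weight_space emb act \<mu>" "x \<noteq> 0"
    and "act (f j) x = 0" "(act (e j) ^^ N) x = 0"
  shows "\<exists>m. \<mu> (coroot j) = - of_nat m \<and>
    (\<forall>a\<le>m. \<exists>y. y \<noteq> 0 \<and> y \<in> weight_space emb act (\<lambda>h. \<mu> h + of_nat a * sroot j h))"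
proof -
  interpret lie_representation act by fact
  have "(act (e j) ^^ a) x \<in> weight_space emb act (\<lambda>h. \<mu> h + of_nat a * sroot j h)" for a
    using monomial_e_weight[OF assms(1,2), of "replicate a j"]
    unfolding monomial_replicate multidegree_replicate by simp
  then show ?thesis
    using sl2_lowest_weight[OF sl2_triple_generators weight_spaceD[OF assms(2)] assms(3-5)] by blast
qed

end

section \<open>Spans of simple roots\<close>

lemma nat_span_zero: "(\<lambda>h. 0) \<in> nat_span S"
  unfolding nat_span_def by (rule CollectI, rule exI[of _ "{}"]) auto

lemma nat_span_add:
  assumes "\<alpha> \<in> S" "\<phi> \<in> nat_span S"
  shows "(\<lambda>h. \<alpha> h + \<phi> h) \<in> nat_span S"
proof -
  obtain T n where T: "finite T" "T \<subseteq> S" "\<phi> = (\<lambda>h. \<Sum>\<psi>\<in>T. of_nat (n \<psi>) * \<psi> h)"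
    using assms(2) by (auto simp: nat_span_def)
  define n' where "n' = (\<lambda>\<psi>. (if \<psi> \<in> T then n \<psi> else 0) + (if \<psi> = \<alpha> then 1 else 0))"
  have "\<alpha> h + \<phi> h = (\<Sum>\<psi>\<in>insert \<alpha> T. of_nat (n' \<psi>) * \<psi> h)" for h
  proof -
    have "(\<Sum>\<psi>\<in>insert \<alpha> T. of_nat (n' \<psi>) * \<psi> h) =
        (\<Sum>\<psi>\<in>insert \<alpha> T. (if \<psi> \<in> T then of_nat (n \<psi>) * \<psi> h else 0))
        + (\<Sum>\<psi>\<in>insert \<alpha> T. (if \<psi> = \<alpha> then \<psi> h else 0))"
      unfolding sum.distrib[symmetric] by (rule sum.cong) (auto simp: n'_def algebra_simps)
    also have "(\<Sum>\<psi>\<in>insert \<alpha> T. (if \<psi> = \<alpha> then \<psi> h else 0)) = \<alpha> h"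
      using T(1) by simp
    also have "(\<Sum>\<psi>\<in>insert \<alpha> T. (if \<psi> \<in> T then of_nat (n \<psi>) * \<psi> h else 0)) = \<phi> h"
      unfolding T(3) using T(1) by (intro sum.mono_neutral_cong_right) auto
    finally show ?thesis by simp
  qed
  then show ?thesis
    unfolding nat_span_def using T(1,2) assms(1)
    by (intro CollectI exI[of _ "insert \<alpha> T"] exI[of _ n']) auto
qed

lemma nat_span_induct [consumes 1, case_names zero add]:
  assumes "\<phi> \<in> nat_span S" "P (\<lambda>h. 0)"
    and add: "\<And>\<alpha> \<psi>. \<alpha> \<in> S \<Longrightarrow> P \<psi> \<Longrightarrow> P (\<lambda>h. \<alpha> h + \<psi> h)"
  shows "P \<phi>"
proof -
  obtain T n where T: "finite T" "T \<subseteq> S" "\<phi> = (\<lambda>h. \<Sum>\<psi>\<in>T. of_nat (n \<psi>) * \<psi> h)"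
    using assms(1) by (auto simp: nat_span_def)
  have "P (\<lambda>h. \<Sum>\<psi>\<in>T. of_nat (n \<psi>) * \<psi> h)"
    using T(1,2)
  proof (induction T rule: finite_induct)
    case (insert \<alpha> T)
    have "P (\<lambda>h. of_nat k * \<alpha> h + (\<Sum>\<psi>\<in>T. of_nat (n \<psi>) * \<psi> h))" for k
    proof (induction k)
      case (Suc k)
      then show ?case using add[OF _ Suc] insert.prems by (simp add: algebra_simps)
    qed (use insert in simp)
    then show ?case using insert.hyps by simp
  qed (use assms(2) in simp)
  then show ?thesis using T(3) by simp
qed

lemma nat_span_mono: "S \<subseteq> T \<Longrightarrow> nat_span S \<subseteq> nat_span T"
  unfolding nat_span_def by blast

lemma minkowski_diff_mono: "D \<subseteq> D' \<Longrightarrow> C \<ominus> D \<subseteq> C \<ominus> D'"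
  unfolding minkowski_diff_def by blast

lemma minkowski_diffI: "c \<in> C \<Longrightarrow> d \<in> D \<Longrightarrow> (\<And>h. \<mu> h = c h - d h) \<Longrightarrow> \<mu> \<in> C \<ominus> D"
  unfolding minkowski_diff_def by blast

lemma minkowski_diffE:
  assumes "\<mu> \<in> C \<ominus> D"
  obtains c d where "c \<in> C" "d \<in> D" "\<mu> = (\<lambda>h. c h - d h)"
  using assms unfolding minkowski_diff_def by blast

lemma root_of_dual:
  assumes "\<And>i. sroot i \<in> dual_space"
  shows "root_of sroot c \<in> dual_space"
  using assms unfolding root_of_def
  by (auto simp: dual_space_iff sum.distrib sum_distrib_left algebra_simps)

context kac_moody
begin

lemma sroot_inj: "inj sroot"
proof
  fix i j assume "sroot i = sroot j"
  then have "root_of sroot (axis i 1) = root_of sroot (axis j 1)" by auto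
  from root_of_inj[OF this] show "i = j" by (simp add: axis_eq_axis)
qed

lemma root_of_sum_sroot:
  assumes "\<And>i. i \<notin> K \<Longrightarrow> c $ i = 0"
  shows "root_of sroot c h = (\<Sum>\<phi>\<in>sroot ` K. of_int (c $ inv sroot \<phi>) * \<phi> h)"
proof -
  have "root_of sroot c h = (\<Sum>i\<in>K. of_int (c $ i) * sroot i h)"
    unfolding root_of_def using assms by (intro sum.mono_neutral_right) auto
  also have "\<dots> = (\<Sum>\<phi>\<in>sroot ` K. of_int (c $ inv sroot \<phi>) * \<phi> h)"
    using sroot_inj by (subst sum.reindex) (auto simp: inj_on_def inj_def)
  finally show ?thesis .
qed

lemma int_span_sroot: "int_span (sroot ` K) = {root_of sroot c | c. \<forall>i. i \<notin> K \<longrightarrow> c $ i = 0}"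
proof (intro equalityI subsetI)
  fix \<phi> assume "\<phi> \<in> int_span (sroot ` K)"
  then obtain T n where T: "finite T" "T \<subseteq> sroot ` K" "\<phi> = (\<lambda>h. \<Sum>\<psi>\<in>T. of_int (n \<psi>) * \<psi> h)"
    by (auto simp: int_span_def)
  obtain K' where K': "K' \<subseteq> K" "T = sroot ` K'" using T(2) by (meson subset_imageE)
  define c where "c = (\<chi> i. if i \<in> K' then n (sroot i) else 0)"
  have "\<phi> = root_of sroot c"
  proof
    fix h
    show "\<phi> h = root_of sroot c h"
      unfolding T(3) K'(2) by (subst root_of_sum_sroot[of K'])
        (auto simp: c_def sroot_inj inv_f_f intro!: sum.cong)
  qed
  moreover have "\<forall>i. i \<notin> K \<longrightarrow> c $ i = 0" using K'(1) by (auto simp: c_def)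
  ultimately show "\<phi> \<in> {root_of sroot c | c. \<forall>i. i \<notin> K \<longrightarrow> c $ i = 0}" by auto
next
  fix \<phi> assume "\<phi> \<in> {root_of sroot c | c. \<forall>i. i \<notin> K \<longrightarrow> c $ i = 0}"
  then obtain c where c: "\<phi> = root_of sroot c" "\<And>i. i \<notin> K \<Longrightarrow> c $ i = 0" by blast
  then show "\<phi> \<in> int_span (sroot ` K)"
    unfolding int_span_def using root_of_sum_sroot[of K c]
    by (intro CollectI exI[of _ "sroot ` K"] exI[of _ "\<lambda>\<phi>. c $ inv sroot \<phi>"]) auto
qed

lemma nat_span_sroot:
  "nat_span (sroot ` K) = {root_of sroot c | c. (\<forall>i. c $ i \<ge> 0) \<and> (\<forall>i. i \<notin> K \<longrightarrow> c $ i = 0)}"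
proof (intro equalityI subsetI)
  fix \<phi> assume "\<phi> \<in> nat_span (sroot ` K)"
  then show "\<phi> \<in> {root_of sroot c | c. (\<forall>i. c $ i \<ge> 0) \<and> (\<forall>i. i \<notin> K \<longrightarrow> c $ i = 0)}"
  proof (induction rule: nat_span_induct)
    case zero
    show ?case by (intro CollectI exI[of _ 0]) auto
  next
    case (add \<alpha> \<psi>)
    then obtain i c where "i \<in> K" "\<alpha> = sroot i" "\<psi> = root_of sroot c" "\<forall>i. c $ i \<ge> 0" "\<forall>i. i \<notin> K \<longrightarrow> c $ i = 0"
      by blast
    moreover from this have "(\<lambda>h. \<alpha> h + \<psi> h) = root_of sroot (axis i 1 + c)" by auto
    ultimately show ?case by (intro CollectI exI[of _ "axis i 1 + c"]) (auto simp: axis_def)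
  qed
next
  fix \<phi> assume "\<phi> \<in> {root_of sroot c | c. (\<forall>i. c $ i \<ge> 0) \<and> (\<forall>i. i \<notin> K \<longrightarrow> c $ i = 0)}"
  then obtain c where c: "\<phi> = root_of sroot c" "\<And>i. c $ i \<ge> 0" "\<And>i. i \<notin> K \<Longrightarrow> c $ i = 0" by blast
  then show "\<phi> \<in> nat_span (sroot ` K)"
    unfolding nat_span_def using root_of_sum_sroot[of K c]
    by (intro CollectI exI[of _ "sroot ` K"] exI[of _ "\<lambda>\<phi>. nat (c $ inv sroot \<phi>)"]) auto
qed

lemma root_of_pos_root:
  assumes "monomial lie_bracket e w (e i) \<noteq> 0"
  shows "root_of sroot (multidegree w + axis i 1) \<in> pos_roots sroot emb"
proof -
  let ?c = "multidegree w + axis i 1"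
  have c: "?c $ k \<ge> 0" for k using multidegree_nonneg[of w k] by (auto simp: axis_def)
  have "root_of sroot ?c \<noteq> (\<lambda>h. 0)"
  proof
    assume "root_of sroot ?c = (\<lambda>h. 0)"
    then have "root_of sroot ?c = root_of sroot 0" by auto
    then have "?c $ i = 0" using root_of_inj by fastforce
    then show False using multidegree_nonneg[of w i] by simp
  qed
  then have "root_of sroot ?c \<in> roots emb"
    unfolding roots_def root_space_eq using assms bracket_e_weight[of w i] root_of_dual[OF sroot_dual]
    by auto
  moreover have "root_of sroot ?c \<in> nat_span (range sroot)"
    unfolding nat_span_sroot using c by auto
  ultimately show ?thesis by (simp add: pos_roots_def)
qed

lemma pos_roots_sub_iff:
  "root_of sroot c \<in> pos_roots_sub sroot emb J \<longleftrightarrow>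
     root_of sroot c \<in> pos_roots sroot emb \<and> (\<forall>i. i \<notin> J \<longrightarrow> c $ i = 0)"
  unfolding pos_roots_sub_def int_span_sroot using root_of_inj by auto

end

section \<open>Positive roots of height one outside a set of nodes\<close>

text \<open>
  The height of a bracket outside \<open>J\<close> is the number of its letters outside \<open>J\<close>; the brackets of
  height zero are those of the Levi part. Level-one brackets are collected with their only outer letter
  innermost, so that removing the first letter of a longer one removes a simple root of \<open>J\<close> from its
  weight.
\<close>

definition level_one :: "('i \<Rightarrow> 'g::complex_lie_algebra) \<Rightarrow> 'i set \<Rightarrow> 'g set" where
  "level_one x J = {monomial lie_bracket x w (x i) | w i. set w \<subseteq> J \<and> i \<notin> J}"

definition levi_brackets :: "('i \<Rightarrow> 'g::complex_lie_algebra) \<Rightarrow> 'i set \<Rightarrow> 'g set" where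
  "levi_brackets x J = {monomial lie_bracket x w (x i) | w i. set w \<subseteq> J \<and> i \<in> J}"

inductive_set iterated_brackets :: "'g::complex_lie_algebra set \<Rightarrow> 'g set" for Y where
  base: "y \<in> Y \<Longrightarrow> y \<in> iterated_brackets Y"
| step: "y \<in> Y \<Longrightarrow> d \<in> iterated_brackets Y \<Longrightarrow> lie_bracket y d \<in> iterated_brackets Y"

lemma level_one_base: "i \<notin> J \<Longrightarrow> x i \<in> level_one x J"
  unfolding level_one_def by (rule CollectI, rule exI[of _ "[]"]) auto

lemma level_one_step: "j \<in> J \<Longrightarrow> y \<in> level_one x J \<Longrightarrow> lie_bracket (x j) y \<in> level_one x J"
  unfolding level_one_def by (clarify, rule_tac x = "j # w" in exI) auto

lemma levi_brackets_step: "j \<in> J \<Longrightarrow> y \<in> levi_brackets x J \<Longrightarrow> lie_bracket (x j) y \<in> levi_brackets x J"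
  unfolding levi_brackets_def by (clarify, rule_tac x = "j # w" in exI) auto

lemma iterated_level_one_step:
  assumes "d \<in> iterated_brackets (level_one x J)" "j \<in> J"
  shows "lie_bracket (x j) d \<in> complex_vector.span (iterated_brackets (level_one x J))" (is "_ \<in> ?S")
  using assms(1)
proof induction
  case (base y)
  then show ?case
    using level_one_step[OF assms(2)] by (intro complex_vector.span_base iterated_brackets.base)
next
  case (step y d)
  have "lie_bracket (lie_bracket (x j) y) d \<in> ?S"
    using level_one_step[OF assms(2)] step by (intro complex_vector.span_base iterated_brackets.step)
  moreover have "lie_bracket y (lie_bracket (x j) d) \<in> ?S"
    using step by (intro adjoint.act_span[OF step.IH])
      (auto intro: complex_vector.span_base iterated_brackets.step)
  ultimately show ?case by (simp add: lie_derivation[of "x j"] complex_vector.span_add)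
qed

text \<open>
  Elements that preserve the span of the level-one brackets form a subalgebra containing the generators
  at \<open>J\<close>. With \<open>y\<close> a generator outside \<open>J\<close>, this moves the outer letter to the innermost place.
\<close>

lemma levi_brackets_level_one:
  assumes "l \<in> levi_brackets x J" "y \<in> level_one x J"
  shows "lie_bracket l y \<in> complex_vector.span (level_one x J)"
proof -
  obtain w i where w: "l = monomial lie_bracket x w (x i)" "set w \<subseteq> J" "i \<in> J"
    using assms(1) by (auto simp: levi_brackets_def)
  show ?thesis using w(2) assms(2) unfolding w(1)
  proof (induction w arbitrary: y)
    case Nil
    then show ?case using w(3) by (auto intro: complex_vector.span_base level_one_step)
  next
    case (Cons j w)
    let ?l = "monomial lie_bracket x w (x i)"
    have "lie_bracket (x j) (lie_bracket ?l y) \<in> complex_vector.span (level_one x J)"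
      using Cons by (intro adjoint.act_span[OF Cons.IH])
        (auto intro: complex_vector.span_base level_one_step)
    moreover have "lie_bracket ?l (lie_bracket (x j) y) \<in> complex_vector.span (level_one x J)"
      using Cons by (intro Cons.IH level_one_step) auto
    ultimately show ?case by (simp add: adjoint.act_bracket complex_vector.span_diff)
  qed
qed

text \<open>
  The span on the right is stable under the generators: those at \<open>J\<close> act on iterated brackets as
  derivations; those outside \<open>J\<close> are themselves level-one brackets, and their brackets with the Levi
  part are combinations of level-one brackets by \<open>levi_brackets_level_one\<close>.
\<close>

lemma brackets_level_decomposition:
  "brackets x \<subseteq> complex_vector.span (iterated_brackets (level_one x J) \<union> levi_brackets x J)"
  (is "_ \<subseteq> ?S")
proof
  fix b assume "b \<in> brackets x"
  then obtain w i where b: "b = monomial lie_bracket x w (x i)" by (auto simp: brackets_def)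
  have D: "complex_vector.span (iterated_brackets (level_one x J)) \<subseteq> ?S"
    by (rule complex_vector.span_mono) blast
  have Y: "complex_vector.span (level_one x J) \<subseteq> ?S"
    by (rule complex_vector.span_mono) (auto intro: iterated_brackets.base)
  show "b \<in> ?S" unfolding b
  proof (induction w)
    case Nil
    show ?case
    proof (cases "i \<in> J")
      case True
      then have "x i \<in> levi_brackets x J"
        unfolding levi_brackets_def by (intro CollectI exI[of _ "[]"]) auto
      then show ?thesis by (simp add: complex_vector.span_base)
    next
      case False
      then show ?thesis by (simp add: complex_vector.span_base iterated_brackets.base level_one_base)
    qed
  next
    case (Cons k w)
    show ?case unfolding monomial_simps
    proof (rule adjoint.act_span[OF Cons])
      fix d assume d: "d \<in> iterated_brackets (level_one x J) \<union> levi_brackets x J"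
      show "lie_bracket (x k) d \<in> ?S"
      proof (cases "k \<in> J")
        case True
        then show ?thesis
          using d D iterated_level_one_step[of d x J k] levi_brackets_step[of k J d x]
          by (auto intro: complex_vector.span_base)
      next
        case False
        from d show ?thesis
        proof
          assume "d \<in> iterated_brackets (level_one x J)"
          then show ?thesis
            using False by (intro complex_vector.span_base UnI1 iterated_brackets.step level_one_base)
        next
          assume "d \<in> levi_brackets x J"
          then have "lie_bracket d (x k) \<in> ?S"
            using subsetD[OF Y levi_brackets_level_one[OF _ level_one_base[OF False]]] by simp
          then have "- lie_bracket d (x k) \<in> ?S" by (rule complex_vector.span_neg)
          then show ?thesis by (subst lie_antisym)
        qed
      qed
    qed simp
  qed
qed

context kac_moody
begin

definition level_one_degrees :: "'i set \<Rightarrow> (int^'i) set" where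
  "level_one_degrees J =
     {multidegree w + axis i 1 | w i. set w \<subseteq> J \<and> i \<notin> J \<and> monomial lie_bracket e w (e i) \<noteq> 0}"

definition height_outside :: "'i set \<Rightarrow> int^'i \<Rightarrow> int" where
  "height_outside J c = (\<Sum>i\<in>- J. c $ i)"

lemma height_outside_add: "height_outside J (c + d) = height_outside J c + height_outside J d"
  and height_outside_minus: "height_outside J (- c) = - height_outside J c"
  by (simp_all add: height_outside_def sum.distrib sum_negf)

lemma height_outside_supported:
  "(\<And>i. i \<notin> J \<Longrightarrow> c $ i = 0) \<Longrightarrow> height_outside J c = 0"
  by (simp add: height_outside_def)

lemma height_outside_axis: "height_outside J (axis i a) = (if i \<in> J then 0 else a)"
proof -
  have "height_outside J (axis i a) = (\<Sum>k\<in>- J. if k = i then a else 0)"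
    unfolding height_outside_def by (rule sum.cong) (auto simp: axis_def)
  then show ?thesis by simp
qed

lemma height_outside_level_one:
  assumes "c \<in> level_one_degrees J"
  shows "height_outside J c = 1"
proof -
  obtain w i where "c = multidegree w + axis i 1" "set w \<subseteq> J" "i \<notin> J"
    using assms by (auto simp: level_one_degrees_def)
  moreover from this have "height_outside J (multidegree w) = 0"
    by (intro height_outside_supported) (auto simp: multidegree_eq_0_iff)
  ultimately show ?thesis by (simp add: height_outside_add height_outside_axis)
qed

lemma height_outside_sum_list:
  "set cs \<subseteq> level_one_degrees J \<Longrightarrow> height_outside J (sum_list cs) = int (length cs)"
proof (induction cs)
  case Nil
  show ?case by (simp add: height_outside_supported)
qed (simp add: height_outside_add height_outside_level_one)

lemma iterated_level_one_degrees:
  assumes "d \<in> iterated_brackets (level_one e J)" "d \<noteq> 0"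
  shows "\<exists>cs. cs \<noteq> [] \<and> set cs \<subseteq> level_one_degrees J \<and>
    d \<in> weight_space emb lie_bracket (root_of sroot (sum_list cs))"
  using assms
proof induction
  case (base y)
  then obtain w i where "y = monomial lie_bracket e w (e i)" "set w \<subseteq> J" "i \<notin> J"
    by (auto simp: level_one_def)
  then show ?case
    using base bracket_e_weight[of w i]
    by (intro exI[of _ "[multidegree w + axis i 1]"])
      (auto simp: level_one_degrees_def simp del: root_of_add)
next
  case (step y d)
  from step.hyps(1) obtain w i where y: "y = monomial lie_bracket e w (e i)" "set w \<subseteq> J" "i \<notin> J"
    by (auto simp: level_one_def)
  have nz: "y \<noteq> 0" "d \<noteq> 0" using step.prems by auto
  from step.IH[OF nz(2)] obtain cs where cs: "set cs \<subseteq> level_one_degrees J"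
    "d \<in> weight_space emb lie_bracket (root_of sroot (sum_list cs))" by blast
  have "lie_bracket y d \<in> weight_space emb lie_bracket
      (\<lambda>h. root_of sroot (multidegree w + axis i 1) h + root_of sroot (sum_list cs) h)"
    unfolding y(1) by (rule adjoint.weight_space_act[OF bracket_e_weight cs(2)])
  then have "lie_bracket y d \<in> weight_space emb lie_bracket
      (root_of sroot (sum_list ((multidegree w + axis i 1) # cs)))"
    by (simp add: weight_space_def)
  moreover have "multidegree w + axis i 1 \<in> level_one_degrees J"
    using y nz by (auto simp: level_one_degrees_def)
  ultimately show ?case
    using cs(1) by (intro exI[of _ "(multidegree w + axis i 1) # cs"]) (auto simp del: root_of_add)
qed

text \<open>
  A root vector may be replaced by a member of the spanning set that has the same weight.
\<close>

lemma root_degree_cases: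
  assumes "x \<in> weight_space emb lie_bracket (root_of sroot c)" "x \<noteq> 0"
  obtains (zero) "c = 0"
    | (level) cs where "cs \<noteq> []" "set cs \<subseteq> level_one_degrees J" "c = sum_list cs"
    | (levi) w i where "set w \<subseteq> J" "i \<in> J" "c = multidegree w + axis i 1"
    | (negative) w i where "c = - (multidegree w + axis i 1)"
proof -
  let ?D = "iterated_brackets (level_one e J)" and ?L = "levi_brackets e J"
  have "range emb \<union> brackets e \<union> brackets f \<subseteq>
      complex_vector.span (range emb \<union> (?D \<union> ?L) \<union> brackets f)"
  proof (intro Un_least)
    show "brackets e \<subseteq> complex_vector.span (range emb \<union> (?D \<union> ?L) \<union> brackets f)"
      by (rule order_trans[OF brackets_level_decomposition[of e J] complex_vector.span_mono]) blast
  qed (auto intro: complex_vector.span_base)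
  then have "complex_vector.span (range emb \<union> (?D \<union> ?L) \<union> brackets f) = UNIV"
    using triangular_decomposition complex_vector.span_mono complex_vector.span_span
    by (metis UNIV_eq_I subset_UNIV top.extremum_unique)
  then have "x \<in> complex_vector.span (range emb \<union> (?D \<union> ?L) \<union> brackets f)" by simp
  then have "\<exists>b\<in>range emb \<union> (?D \<union> ?L) \<union> brackets f. b \<noteq> 0 \<and>
      b \<in> weight_space emb lie_bracket (root_of sroot c)"
  proof (rule adjoint.weight_vector_in_span[OF _ assms])
    fix b assume "b \<in> range emb \<union> (?D \<union> ?L) \<union> brackets f"
    then show "\<exists>\<nu>. b \<in> weight_space emb lie_bracket \<nu>"
      using emb_weight bracket_f_weight bracket_e_weight iterated_level_one_degrees[of b J]
        adjoint.zero_in_weight_space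
      unfolding brackets_def levi_brackets_def by (cases "b = 0") blast+
  qed
  then obtain b where b: "b \<in> range emb \<union> (?D \<union> ?L) \<union> brackets f" "b \<noteq> 0"
    "b \<in> weight_space emb lie_bracket (root_of sroot c)" by blast
  have same: "c = d" if "b \<in> weight_space emb lie_bracket (root_of sroot d)" for d
    using adjoint.weight_unique[OF b(3) that b(2)] by (rule root_of_inj)
  from b(1) consider "b \<in> range emb" | "b \<in> ?D" | "b \<in> ?L" | "b \<in> brackets f" by blast
  then show thesis
  proof cases
    case 1
    then have "b \<in> weight_space emb lie_bracket (root_of sroot 0)"
      using emb_weight by (auto simp: weight_space_def)
    then show ?thesis using zero same by blast
  next
    case 2
    then show ?thesis using iterated_level_one_degrees[OF 2 b(2)] same level by blast
  next
    case 3
    then show ?thesis using bracket_e_weight same levi unfolding levi_brackets_def by blast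
  next
    case 4
    then obtain w i where "b = monomial lie_bracket f w (f i)" by (auto simp: brackets_def)
    then have "b \<in> weight_space emb lie_bracket (root_of sroot (- (multidegree w + axis i 1)))"
      using bracket_f_weight[of w i] by (simp add: weight_space_def)
    then show ?thesis using same negative by blast
  qed
qed

text \<open>
  The height outside \<open>J\<close> of a sum of level-one degrees is the number of summands, so among the cases
  of \<open>root_degree_cases\<close> only a single level-one degree has height one.
\<close>

lemma level_one_if_height_one:
  assumes "x \<in> weight_space emb lie_bracket (root_of sroot c)" "x \<noteq> 0" "height_outside J c = 1"
  shows "c \<in> level_one_degrees J"
  using assms(1,2)
proof (cases rule: root_degree_cases[where J = J])
  case zero
  then show ?thesis using assms(3) by (simp add: height_outside_supported)
next
  case (level cs)
  then have "length cs = 1" using assms(3) height_outside_sum_list[of cs J] by simp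
  then obtain d where "cs = [d]" by (cases cs) auto
  then show ?thesis using level by simp
next
  case (levi w i)
  then have "height_outside J c = 0"
    by (intro height_outside_supported) (auto simp: multidegree_eq_0_iff axis_def)
  then show ?thesis using assms(3) by simp
next
  case (negative w i)
  have "height_outside J (multidegree w + axis i 1) \<ge> 0"
    unfolding height_outside_def using multidegree_nonneg[of w] by (intro sum_nonneg) (auto simp: axis_def)
  then show ?thesis
    using assms(3) height_outside_minus[of J "multidegree w + axis i 1"] negative by simp
qed

lemma level_one_nonneg: "c \<in> level_one_degrees J \<Longrightarrow> c $ k \<ge> 0"
  unfolding level_one_degrees_def using multidegree_nonneg[of _ k] by (auto simp: axis_def)

text \<open>
  A level-one root that is not simple remains a level-one root after removal of a suitable simple root
  of \<open>J\<close>; this drives the induction on heights in \<open>weights_minus_level_one\<close>.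
\<close>

lemma level_one_cases:
  assumes "c \<in> level_one_degrees J"
  obtains i where "i \<notin> J" "c = axis i 1"
  | j where "j \<in> J" "c - axis j 1 \<in> level_one_degrees J"
proof -
  obtain w i where w: "c = multidegree w + axis i 1" "set w \<subseteq> J" "i \<notin> J" "monomial lie_bracket e w (e i) \<noteq> 0"
    using assms by (auto simp: level_one_degrees_def)
  show thesis
  proof (cases w)
    case Nil
    then show ?thesis using w that(1)[of i] by simp
  next
    case (Cons j v)
    then have "monomial lie_bracket e v (e i) \<noteq> 0" using w(4) by auto
    then have "c - axis j 1 \<in> level_one_degrees J"
      using w Cons by (auto simp: level_one_degrees_def)
    then show ?thesis using that(2)[of j] w Cons by simp
  qed
qed

definition coroot_pairing :: "'i \<Rightarrow> int^'i \<Rightarrow> int" where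
  "coroot_pairing j c = (\<Sum>i\<in>UNIV. c $ i * A j i)"

lemma root_of_coroot: "root_of sroot c (coroot j) = of_int (coroot_pairing j c)"
  by (simp add: root_of_def coroot_pairing_def sroot_coroot)

lemma coroot_pairing_add [simp]: "coroot_pairing j (c + d) = coroot_pairing j c + coroot_pairing j d"
  and coroot_pairing_diff [simp]: "coroot_pairing j (c - d) = coroot_pairing j c - coroot_pairing j d"
  by (simp_all add: coroot_pairing_def algebra_simps sum.distrib sum_subtractf)

lemma coroot_pairing_axis [simp]: "coroot_pairing j (axis j a) = 2 * a"
proof -
  have "coroot_pairing j (axis j a) = (\<Sum>i\<in>UNIV. if i = j then 2 * a else 0)"
    unfolding coroot_pairing_def by (rule sum.cong) (auto simp: axis_def cartan_diag)
  then show ?thesis by simp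
qed

lemma coroot_pairing_sum_list: "coroot_pairing j (sum_list cs) = (\<Sum>c\<leftarrow>cs. coroot_pairing j c)"
proof (induction cs)
  case Nil
  show ?case by (simp add: coroot_pairing_def)
qed simp

text \<open>
  The degree on the right is that of the reflection of the root at \<open>j\<close>. Reflecting at a node of \<open>J\<close>
  leaves the height outside \<open>J\<close> unchanged.
\<close>

lemma level_one_string:
  assumes "c \<in> level_one_degrees J" "j \<in> J" "coroot_pairing j c \<ge> 0"
  shows "c - axis j (coroot_pairing j c) \<in> level_one_degrees J"
proof -
  let ?p = "coroot_pairing j c"
  obtain w i where w: "c = multidegree w + axis i 1" "monomial lie_bracket e w (e i) \<noteq> 0"
    using assms by (auto simp: level_one_degrees_def)
  obtain N where N: "(lie_bracket (e j) ^^ N) (monomial lie_bracket e w (e i)) = 0"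
    using e_locally_nilpotent by blast
  have "monomial lie_bracket e w (e i) \<in> weight_space emb lie_bracket (root_of sroot c)"
    using bracket_e_weight w by simp
  from weight_string_down[OF lie_representation_adjoint this w(2) root_of_coroot N, of "nat ?p"] assms(3)
  obtain y where y: "y \<noteq> 0"
    "y \<in> weight_space emb lie_bracket (\<lambda>h. root_of sroot c h - of_nat (nat ?p) * sroot j h)" by auto
  have "(of_nat (nat ?p) :: complex) = of_int ?p" using assms(3) by simp
  then have "y \<in> weight_space emb lie_bracket (root_of sroot (c - axis j ?p))"
    using y(2) by (simp add: weight_space_def)
  moreover have "height_outside J (c - axis j ?p) = 1"
    using height_outside_add[of J "c - axis j ?p" "axis j ?p"] height_outside_level_one[OF assms(1)] assms(2)
    by (simp add: height_outside_axis)
  ultimately show ?thesis using level_one_if_height_one y(1) by blast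
qed

lemma nat_span_outside_roots:
  assumes "\<phi> \<in> nat_span (pos_roots sroot emb - pos_roots_sub sroot emb J)"
  shows "\<exists>cs. set cs \<subseteq> level_one_degrees J \<and> \<phi> = root_of sroot (sum_list cs)"
  using assms
proof (induction rule: nat_span_induct)
  case zero
  show ?case by (intro exI[of _ "[]"]) auto
next
  case (add \<alpha> \<psi>)
  from add(2) obtain cs where cs: "set cs \<subseteq> level_one_degrees J" "\<psi> = root_of sroot (sum_list cs)" by blast
  have "\<alpha> \<in> nat_span (range sroot)" and root: "\<alpha> \<in> roots emb"
    using add(1) by (auto simp: pos_roots_def)
  then obtain c where c: "\<alpha> = root_of sroot c" "\<And>i. c $ i \<ge> 0" by (auto simp: nat_span_sroot)
  obtain x where x: "x \<in> weight_space emb lie_bracket (root_of sroot c)" "x \<noteq> 0"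
    using root c(1) by (auto simp: roots_def root_space_eq)
  from x have "\<exists>ds. set ds \<subseteq> level_one_degrees J \<and> c = sum_list ds"
  proof (cases rule: root_degree_cases[where J = J])
    case zero
    then have "\<alpha> = (\<lambda>h. 0)" using c(1) by auto
    then show ?thesis using root by (simp add: roots_def)
  next
    case (levi w i)
    then have "\<forall>i. i \<notin> J \<longrightarrow> c $ i = 0" by (auto simp: multidegree_eq_0_iff axis_def)
    then show ?thesis using add(1) c(1) pos_roots_sub_iff by blast
  next
    case (negative w i)
    then show ?thesis using c(2)[of i] multidegree_nonneg[of w i] by simp
  qed blast
  then obtain ds where "set ds \<subseteq> level_one_degrees J" "c = sum_list ds" by blast
  then show ?case using cs c(1) by (intro exI[of _ "ds @ cs"]) auto
qed

end

section \<open>Highest weight modules\<close>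

text \<open>
  The highest weight vector is a parameter, so that vectors and subspaces built from it can be named.
\<close>

locale kac_moody_module =
  kac_moody A coroot sroot emb e f + lie_representation act
  for A :: "'i::finite \<Rightarrow> 'i \<Rightarrow> int"
    and coroot :: "'i \<Rightarrow> 'h::complex_vector"
    and sroot :: "'i \<Rightarrow> 'h \<Rightarrow> complex"
    and emb :: "'h \<Rightarrow> 'g::complex_lie_algebra"
    and e f :: "'i \<Rightarrow> 'g"
    and act :: "'g \<Rightarrow> 'v::complex_vector \<Rightarrow> 'v" +
  fixes \<Lambda> :: "'h \<Rightarrow> complex" and v :: 'v
  assumes weight_dual: "\<Lambda> \<in> dual_space"
    and e_v: "act (e i) v = 0"
    and v_weight: "v \<in> weight_space emb act \<Lambda>"
    and v_generates: "submodule act W \<Longrightarrow> v \<in> W \<Longrightarrow> W = UNIV"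
begin

lemma monomial_v_weight:
  "monomial act f w v \<in> weight_space emb act (\<lambda>h. \<Lambda> h - root_of sroot (multidegree w) h)"
  by (rule monomial_f_weight[OF lie_representation_axioms v_weight])

text \<open>
  The span of the \<open>f\<close>-monomials on \<open>v\<close> is a submodule: an \<open>e\<^sub>i\<close> is moved to the right until it kills \<open>v\<close>,
  and the coroots that arise act by scalars.
\<close>

lemma generated_by_monomials:
  assumes "complex_vector.subspace W" "v \<in> W" "\<And>i x. x \<in> W \<Longrightarrow> act (f i) x \<in> W"
  shows "W = UNIV"
proof -
  let ?S = "complex_vector.span {monomial act f w v | w. True}"
  have mon: "monomial act f w v \<in> ?S" for w
    by (rule complex_vector.span_base) auto
  have lower: "act (f i) x \<in> ?S" if "x \<in> ?S" for i x
  proof (rule act_span[OF that])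
    fix b assume "b \<in> {monomial act f w v | w. True}"
    then obtain w where "b = monomial act f w v" by blast
    then show "act (f i) b \<in> ?S" using mon[of "i # w"] by simp
  qed simp
  have raise: "act (e i) (monomial act f w v) \<in> ?S" for i w
  proof (induction w)
    case Nil
    show ?case by (simp add: e_v complex_vector.span_zero)
  next
    case (Cons j w)
    have "act (lie_bracket (e i) (f j)) (monomial act f w v) \<in> ?S"
      unfolding coroot_weight[OF lie_representation_axioms monomial_v_weight]
      using mon by (rule complex_vector.span_scale)
    then show ?case
      using lower[OF Cons] by (simp add: act_commute[of "e i"] complex_vector.span_add)
  qed
  have "submodule act ?S" unfolding submodule_def
  proof (intro conjI allI ballI)
    fix x s assume "s \<in> ?S"
    then show "act x s \<in> ?S"
    proof (rule stable_under_generators[OF lie_representation_axioms, rotated -1])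
      fix i s assume s: "s \<in> ?S"
      show "act (f i) s \<in> ?S" using s by (rule lower)
      show "act (e i) s \<in> ?S" by (rule act_span[OF s]) (use raise in auto)
    next
      fix h s assume s: "s \<in> ?S"
      show "act (emb h) s \<in> ?S"
      proof (rule act_span[OF s])
        fix b assume "b \<in> {monomial act f w v | w. True}"
        then obtain w where "b = monomial act f w v" by blast
        then show "act (emb h) b \<in> ?S"
          using weight_spaceD[OF monomial_v_weight] mon by (auto intro: complex_vector.span_scale)
      qed simp
    qed simp
  qed simp
  then have "?S = UNIV" using mon[of "[]"] by (intro v_generates) auto
  moreover have "monomial act f w v \<in> W" for w
    using assms by (induction w) auto
  then have "?S \<subseteq> W" using assms(1) by (intro complex_vector.span_minimal) auto
  ultimately show ?thesis by blast
qed

text \<open>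
  The sign is chosen so that \<open>c\<close> is non-negative: it is the degree that has been subtracted from \<open>\<Lambda>\<close>.
\<close>

definition has_weight :: "int^'i \<Rightarrow> bool" where
  "has_weight c \<longleftrightarrow> (\<exists>x. x \<noteq> 0 \<and> x \<in> weight_space emb act (\<lambda>h. \<Lambda> h - root_of sroot c h))"

lemma weight_diff_inj:
  assumes "(\<lambda>h. \<Lambda> h - root_of sroot c h) = (\<lambda>h. \<Lambda> h - root_of sroot d h)"
  shows "c = d"
  using root_of_inj[of c d] assms by (simp add: fun_eq_iff)

lemma weight_vector_monomial:
  assumes "x \<noteq> 0" "x \<in> weight_space emb act \<mu>"
  obtains w where "monomial act f w v \<noteq> 0" "\<mu> = (\<lambda>h. \<Lambda> h - root_of sroot (multidegree w) h)"
proof -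
  let ?S = "complex_vector.span {monomial act f w v | w. True}"
  have "?S = UNIV"
  proof (rule generated_by_monomials)
    show "v \<in> ?S" by (rule complex_vector.span_base) (auto intro: exI[of _ "[]"])
    fix i x assume "x \<in> ?S"
    then show "act (f i) x \<in> ?S"
    proof (rule act_span)
      fix b assume "b \<in> {monomial act f w v | w. True}"
      then obtain w where "b = monomial act f w v" by blast
      then have "act (f i) b = monomial act f (i # w) v" by simp
      then show "act (f i) b \<in> ?S" by (intro complex_vector.span_base) blast
    qed simp
  qed simp
  then have "x \<in> ?S" by simp
  from weight_vector_in_span[OF this assms(2,1)] monomial_v_weight
  obtain w where "monomial act f w v \<noteq> 0" "monomial act f w v \<in> weight_space emb act \<mu>" by blast
  then show thesis using that weight_unique[OF _ monomial_v_weight] by blast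
qed

lemma has_weight_monomial:
  assumes "has_weight c"
  obtains w where "monomial act f w v \<noteq> 0" "multidegree w = c"
  using assms weight_vector_monomial weight_diff_inj unfolding has_weight_def by metis

lemma monomial_has_weight: "monomial act f w v \<noteq> 0 \<Longrightarrow> has_weight (multidegree w)"
  unfolding has_weight_def using monomial_v_weight by blast

lemma has_weight_nonneg: "has_weight c \<Longrightarrow> c $ i \<ge> 0"
  by (metis has_weight_monomial multidegree_nonneg)

lemma wt_eq: "wt emb act = {\<lambda>h. \<Lambda> h - root_of sroot c h | c. has_weight c}"
proof (intro equalityI subsetI)
  fix \<mu> assume "\<mu> \<in> wt emb act"
  then obtain x where "x \<noteq> 0" "x \<in> weight_space emb act \<mu>"
    unfolding wt_def using zero_in_weight_space by blast
  then obtain w where "monomial act f w v \<noteq> 0" "\<mu> = (\<lambda>h. \<Lambda> h - root_of sroot (multidegree w) h)"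
    by (rule weight_vector_monomial)
  then show "\<mu> \<in> {\<lambda>h. \<Lambda> h - root_of sroot c h | c. has_weight c}"
    using monomial_has_weight by blast
next
  fix \<mu> assume "\<mu> \<in> {\<lambda>h. \<Lambda> h - root_of sroot c h | c. has_weight c}"
  then obtain c where c: "\<mu> = (\<lambda>h. \<Lambda> h - root_of sroot c h)" "has_weight c" by blast
  have "\<mu> \<in> dual_space"
    using weight_dual root_of_dual[of sroot c, OF sroot_dual] unfolding c(1)
    by (auto simp: dual_space_iff algebra_simps)
  then show "\<mu> \<in> wt emb act" using c unfolding wt_def has_weight_def by auto
qed

lemma in_wt_iff: "(\<lambda>h. \<Lambda> h - root_of sroot c h) \<in> wt emb act \<longleftrightarrow> has_weight c"
  unfolding wt_eq using weight_diff_inj by blast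

lemma wt_sub_eq:
  "wt_sub sroot emb act \<Lambda> J =
     {\<lambda>h. \<Lambda> h - root_of sroot c h | c. has_weight c \<and> (\<forall>i. i \<notin> J \<longrightarrow> c $ i = 0)}"
proof (intro equalityI subsetI)
  fix \<mu> assume \<mu>: "\<mu> \<in> wt_sub sroot emb act \<Lambda> J"
  then obtain d where d: "\<mu> = (\<lambda>h. \<Lambda> h - root_of sroot d h)" "\<forall>i. i \<notin> J \<longrightarrow> d $ i = 0"
    unfolding wt_sub_def nat_span_sroot minkowski_diff_def by auto
  moreover have "has_weight d" using \<mu> d(1) in_wt_iff by (simp add: wt_sub_def)
  ultimately show "\<mu> \<in> {\<lambda>h. \<Lambda> h - root_of sroot c h | c. has_weight c \<and> (\<forall>i. i \<notin> J \<longrightarrow> c $ i = 0)}"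
    by blast
next
  fix \<mu> assume "\<mu> \<in> {\<lambda>h. \<Lambda> h - root_of sroot c h | c. has_weight c \<and> (\<forall>i. i \<notin> J \<longrightarrow> c $ i = 0)}"
  then obtain c where c: "\<mu> = (\<lambda>h. \<Lambda> h - root_of sroot c h)" "has_weight c" "\<forall>i. i \<notin> J \<longrightarrow> c $ i = 0"
    by blast
  then have "root_of sroot c \<in> nat_span (sroot ` J)"
    unfolding nat_span_sroot using has_weight_nonneg by blast
  then show "\<mu> \<in> wt_sub sroot emb act \<Lambda> J"
    unfolding wt_sub_def using c in_wt_iff by (auto intro: minkowski_diffI)
qed

subsection \<open>Weights and strings\<close>

text \<open>Sufficiently many \<open>e\<^sub>j\<close> would lead to a weight that is not below \<open>\<Lambda>\<close>.\<close>

lemma e_nilpotent: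
  assumes "x \<in> weight_space emb act (\<lambda>h. \<Lambda> h - root_of sroot c h)"
  shows "\<exists>N. (act (e j) ^^ N) x = 0"
proof (rule ccontr)
  let ?N = "nat (c $ j) + 1"
  assume "\<not> ?thesis"
  then have "(act (e j) ^^ ?N) x \<noteq> 0" by blast
  moreover have "(act (e j) ^^ ?N) x \<in> weight_space emb act
      (\<lambda>h. \<Lambda> h - root_of sroot (c - axis j (int ?N)) h)"
    using monomial_e_weight[OF lie_representation_axioms assms, of "replicate ?N j"]
    unfolding monomial_replicate multidegree_replicate by (simp add: algebra_simps)
  ultimately have "has_weight (c - axis j (int ?N))" unfolding has_weight_def by blast
  then have "(c - axis j (int ?N)) $ j \<ge> 0" by (rule has_weight_nonneg)
  then show False by (auto split: if_splits)
qed

lemma has_weight_down: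
  assumes "has_weight c" "\<Lambda> (coroot j) - of_int (coroot_pairing j c) = of_int p" "int l \<le> p"
  shows "has_weight (c + axis j (int l))"
proof -
  obtain x where x: "x \<noteq> 0" "x \<in> weight_space emb act (\<lambda>h. \<Lambda> h - root_of sroot c h)"
    using assms(1) by (auto simp: has_weight_def)
  obtain N where "(act (e j) ^^ N) x = 0" using e_nilpotent[OF x(2)] by blast
  from weight_string_down[OF lie_representation_axioms x(2,1) _ this assms(3)] assms(2)
  show ?thesis unfolding has_weight_def by (simp add: root_of_coroot algebra_simps)
qed

lemma has_weight_up:
  assumes "has_weight c" "\<not> has_weight (c + axis j 1)"
  shows "\<exists>m. \<Lambda> (coroot j) - of_int (coroot_pairing j c) = - of_nat m \<and>
    (\<forall>a\<le>m. has_weight (c - axis j (int a)))"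
proof -
  obtain x where x: "x \<noteq> 0" "x \<in> weight_space emb act (\<lambda>h. \<Lambda> h - root_of sroot c h)"
    using assms(1) by (auto simp: has_weight_def)
  obtain N where N: "(act (e j) ^^ N) x = 0" using e_nilpotent[OF x(2)] by blast
  have "act (f j) x \<in> weight_space emb act (\<lambda>h. \<Lambda> h - root_of sroot (c + axis j 1) h)"
    using weight_space_act[OF f_weight[of j] x(2)] by (simp add: algebra_simps)
  then have "act (f j) x = 0" using assms(2) by (auto simp: has_weight_def)
  from weight_string_up[OF lie_representation_axioms x(2,1) this N]
  show ?thesis unfolding has_weight_def by (simp add: root_of_coroot algebra_simps)
qed

text \<open>
  Here \<open>\<mu> = \<Lambda> - c\<close>, the \<open>\<gamma>\<^sub>t\<close> are the members of \<open>cs\<close>, and \<open>\<nu> = \<mu> - \<Sum> \<gamma>\<^sub>t\<close>. In the case that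
  \<open>\<mu> - \<alpha>\<^sub>j\<close> is not a weight, let \<open>m = -\<langle>\<mu>, \<alpha>\<^sub>j\<^sup>\<or>\<rangle>\<close> and \<open>q\<^sub>t = \<langle>\<gamma>\<^sub>t, \<alpha>\<^sub>j\<^sup>\<or>\<rangle>\<close>. Sl2 theory leads from
  \<open>\<nu> + l\<alpha>\<^sub>j\<close> down to \<open>\<nu>\<close> if \<open>l \<le> \<langle>\<nu> + l\<alpha>\<^sub>j, \<alpha>\<^sub>j\<^sup>\<or>\<rangle> = 2l - m - \<Sum> q\<^sub>t\<close>, that is, if \<open>l \<ge> m + \<Sum> q\<^sub>t\<close>.
  Raising \<open>\<mu>\<close> by \<open>m\<alpha>\<^sub>j\<close> and lowering each \<open>\<gamma>\<^sub>t\<close> by \<open>b\<^sub>t\<alpha>\<^sub>j\<close> with \<open>b\<^sub>t \<ge> max 0 q\<^sub>t\<close> achieves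
  \<open>l = m + \<Sum> b\<^sub>t\<close>; the choice \<open>b\<^sub>t = max 0 q\<^sub>t\<close> is the reflection or no change.
\<close>

lemma weights_minus_level_one:
  assumes simple: "\<And>c d. has_weight c \<Longrightarrow> (\<And>i. i \<notin> J \<Longrightarrow> c $ i = 0) \<Longrightarrow> (\<And>i. d $ i \<ge> 0) \<Longrightarrow>
      (\<And>i. i \<in> J \<Longrightarrow> d $ i = 0) \<Longrightarrow> has_weight (c + d)"
  assumes "set cs \<subseteq> level_one_degrees J" "has_weight c" "\<And>i. i \<notin> J \<Longrightarrow> c $ i = 0"
  shows "has_weight (c + sum_list cs)"
  using assms(2-)
proof (induction "nat (height_outside {} (sum_list cs))" arbitrary: cs c rule: less_induct)
  case less
  have nonneg: "sum_list ds $ i \<ge> 0" if "set ds \<subseteq> level_one_degrees J" for ds i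
    using that level_one_nonneg by (induction ds) auto
  have height: "nat (height_outside {} (sum_list ds)) < nat (height_outside {} (sum_list cs))"
    if ds: "set ds \<subseteq> level_one_degrees J" "sum_list ds = sum_list cs - axis j a" "a > 0" for ds j a
  proof -
    have "height_outside {} (sum_list ds) \<ge> 0"
      unfolding height_outside_def using nonneg[OF ds(1)] by (intro sum_nonneg) auto
    moreover have "sum_list cs = sum_list ds + axis j a" using ds(2) by simp
    then have "height_outside {} (sum_list cs) = height_outside {} (sum_list ds) + a"
      by (simp add: height_outside_add height_outside_axis)
    ultimately show ?thesis using ds(3) by linarith
  qed
  show ?case
  proof (cases "\<exists>\<gamma>\<in>set cs. \<exists>j\<in>J. \<gamma> - axis j 1 \<in> level_one_degrees J")
    case False
    have "\<gamma> $ i = 0" if "\<gamma> \<in> set cs" "i \<in> J" for \<gamma> i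
    proof -
      have "\<gamma> \<in> level_one_degrees J" using that less.prems(1) by blast
      then have "\<exists>k. k \<notin> J \<and> \<gamma> = axis k 1"
        by (cases rule: level_one_cases) (use False that(1) in blast)+
      then show ?thesis using that(2) by (auto simp: axis_def)
    qed
    then have "sum_list cs $ i = 0" if "i \<in> J" for i
      using that by (induction cs) auto
    then show ?thesis using simple less.prems nonneg by blast
  next
    case True
    then obtain \<gamma>0 j where \<gamma>0: "\<gamma>0 \<in> set cs" "j \<in> J" "\<gamma>0 - axis j 1 \<in> level_one_degrees J" by blast
    show ?thesis
    proof (cases "has_weight (c + axis j 1)")
      case True
      obtain us ws where cs: "cs = us @ \<gamma>0 # ws" using \<gamma>0(1) by (meson split_list)
      let ?cs' = "us @ (\<gamma>0 - axis j 1) # ws"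
      have cs': "set ?cs' \<subseteq> level_one_degrees J" "sum_list ?cs' = sum_list cs - axis j 1"
        using less.prems(1) \<gamma>0(3) cs by auto
      have "has_weight ((c + axis j 1) + sum_list ?cs')"
        using less.prems(3) \<gamma>0(2) True by (intro less.hyps height[OF cs'] cs') (auto simp: axis_def)
      then show ?thesis unfolding cs'(2) by (simp add: algebra_simps)
    next
      case False
      then obtain m where m: "\<Lambda> (coroot j) - of_int (coroot_pairing j c) = - of_nat m"
        "has_weight (c - axis j (int m))" using has_weight_up less.prems(2) by blast
      \<comment> \<open>For \<open>\<gamma>0\<close> at least one simple root is removed, so that the total height drops even if no
        \<open>\<gamma>\<close> pairs positively with the coroot.\<close>
      define b where "b \<gamma> = max (if \<gamma> = \<gamma>0 then 1 else 0) (coroot_pairing j \<gamma>)" for \<gamma>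
      define B where "B = (\<Sum>\<gamma>\<leftarrow>cs. b \<gamma>)"
      let ?cs' = "map (\<lambda>\<gamma>. \<gamma> - axis j (b \<gamma>)) cs"
      have "\<gamma> - axis j (b \<gamma>) \<in> level_one_degrees J" if "\<gamma> \<in> set cs" for \<gamma>
      proof -
        have \<gamma>: "\<gamma> \<in> level_one_degrees J" using that less.prems(1) by blast
        have "b \<gamma> = 0 \<or> \<gamma> = \<gamma>0 \<and> b \<gamma> = 1 \<or> b \<gamma> = coroot_pairing j \<gamma> \<and> coroot_pairing j \<gamma> \<ge> 0"
          by (auto simp: b_def max_def)
        then consider "b \<gamma> = 0" | "\<gamma> = \<gamma>0" "b \<gamma> = 1"
          | "b \<gamma> = coroot_pairing j \<gamma>" "coroot_pairing j \<gamma> \<ge> 0"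
          by blast
        then show ?thesis
        proof cases
          case 1
          then have "axis j (b \<gamma>) = 0" by simp
          then show ?thesis using \<gamma> by (simp only: diff_zero)
        next
          case 2
          then show ?thesis using \<gamma>0(3) by simp
        next
          case 3
          then show ?thesis using level_one_string[OF \<gamma> \<gamma>0(2)] by simp
        qed
      qed
      then have 1: "set ?cs' \<subseteq> level_one_degrees J" by auto
      have 2: "sum_list ?cs' = sum_list cs - axis j B"
        unfolding B_def by (induction cs) (simp_all add: vec_eq_iff axis_def)
      have "b \<gamma> \<ge> 0" for \<gamma> by (auto simp: b_def max_def)
      then have "b \<gamma>0 \<le> B" unfolding B_def using \<gamma>0(1) by (intro member_le_sum_list) auto
      then have B1: "B > 0" using b_def[of \<gamma>0] by auto
      have B2: "coroot_pairing j (sum_list cs) \<le> B"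
        unfolding B_def coroot_pairing_sum_list by (rule sum_list_mono) (simp add: b_def)
      let ?d = "(c - axis j (int m)) + sum_list ?cs'"
      have d: "has_weight ?d"
        using less.prems(3) \<gamma>0(2) m(2) by (intro less.hyps height[OF 1 2 B1] 1) (auto simp: axis_def)
      let ?l = "int m + B"
      have "has_weight (?d + axis j (int (nat ?l)))"
      proof (rule has_weight_down[OF d])
        have pairing: "coroot_pairing j ?d = coroot_pairing j c + coroot_pairing j (sum_list cs) - 2 * ?l"
          unfolding 2 by simp
        show "\<Lambda> (coroot j) - of_int (coroot_pairing j ?d) =
            of_int (2 * ?l - int m - coroot_pairing j (sum_list cs))"
          unfolding pairing using m(1) by (simp add: algebra_simps)
        show "int (nat ?l) \<le> 2 * ?l - int m - coroot_pairing j (sum_list cs)"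
          using B1 B2 by simp
      qed
      moreover have "?d + axis j (int (nat ?l)) = c + sum_list cs"
        unfolding 2 using B1 by (simp add: vec_eq_iff axis_def)
      ultimately show ?thesis by (simp only:)
    qed
  qed
qed

subsection \<open>Directions outside the integrability set\<close>

lemma act_e_monomial:
  assumes "i \<notin> set w"
  shows "(act (e i) ^^ n) (monomial act f w x) = monomial act f w ((act (e i) ^^ n) x)"
proof -
  have "act (e i) (monomial act f w x) = monomial act f w (act (e i) x)" for x
    using assms by (induction w) (auto simp: act_commute[of "e i"] e_f_diff)
  then show ?thesis by (induction n) simp_all
qed

lemma monomial_scale: "monomial act y w (a *\<^sub>C x) = a *\<^sub>C monomial act y w x"
  by (induction w) (simp_all add: act_scale_right)

text \<open>
  The powers \<open>f\<^sub>i\<^sup>n\<close> are inserted next to \<open>v\<close>, one node after the other. The monomials stay nonzero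
  because \<open>e\<^sub>i\<^sup>n\<close> passes the letters different from \<open>i\<close> and turns \<open>f\<^sub>i\<^sup>n v\<close> back into a nonzero multiple
  of \<open>v\<close>. Placed elsewhere, \<open>f\<^sub>i\<close> could meet a vector on which it is nilpotent.
\<close>

lemma extend_monomial:
  assumes "finite K" "\<And>i. i \<in> K \<Longrightarrow> \<Lambda> (coroot i) \<notin> \<nat>"
    and "\<And>i. d $ i \<ge> 0" "\<And>i. i \<notin> K \<Longrightarrow> d $ i = 0"
    and "set w \<inter> K = {}" "monomial act f w v \<noteq> 0"
  shows "\<exists>u. set u \<subseteq> K \<and> multidegree u = d \<and> monomial act f (w @ u) v \<noteq> 0"
  using assms
proof (induction K arbitrary: d rule: finite_induct)
  case empty
  then show ?case by (intro exI[of _ "[]"]) (auto simp: vec_eq_iff)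
next
  case (insert i K)
  let ?n = "nat (d $ i)"
  have "\<exists>u. set u \<subseteq> K \<and> multidegree u = d - axis i (d $ i) \<and> monomial act f (w @ u) v \<noteq> 0"
    using insert.prems insert.hyps by (intro insert.IH) (auto simp: axis_def)
  then obtain u where u: "set u \<subseteq> K" "multidegree u = d - axis i (d $ i)" "monomial act f (w @ u) v \<noteq> 0"
    by blast
  have i: "i \<notin> set (w @ u)" using u(1) insert by auto
  have "\<Lambda> (coroot i) \<notin> \<nat>" using insert.prems(1) by simp
  then have "\<Lambda> (coroot i) \<noteq> of_nat k" for k by auto
  then obtain a where a: "a \<noteq> 0" "(act (e i) ^^ ?n) ((act (f i) ^^ ?n) v) = a *\<^sub>C v"
    using sl2_raise_lowered_power[OF sl2_triple_generators weight_spaceD[OF v_weight] e_v] by blast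
  have "(act (e i) ^^ ?n) (monomial act f (w @ u) ((act (f i) ^^ ?n) v)) = a *\<^sub>C monomial act f (w @ u) v"
    unfolding act_e_monomial[OF i] a(2) by (rule monomial_scale)
  then have "monomial act f (w @ u) ((act (f i) ^^ ?n) v) \<noteq> 0"
    using a(1) u(3) by force
  then have "monomial act f (w @ u @ replicate ?n i) v \<noteq> 0"
    by (simp add: monomial_replicate)
  moreover have "multidegree (u @ replicate ?n i) = d"
    using u(2) insert.prems(2)[of i] by (simp add: multidegree_append multidegree_replicate)
  ultimately show ?case using u(1) by (intro exI[of _ "u @ replicate ?n i"]) auto
qed

lemma has_weight_outside_J_set:
  assumes "has_weight c" "\<And>i. i \<notin> J_set coroot \<Lambda> \<Longrightarrow> c $ i = 0"
    and "\<And>i. d $ i \<ge> 0" "\<And>i. i \<in> J_set coroot \<Lambda> \<Longrightarrow> d $ i = 0"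
  shows "has_weight (c + d)"
proof -
  obtain w where w: "monomial act f w v \<noteq> 0" "multidegree w = c" using assms(1) by (rule has_weight_monomial)
  have disjoint: "set w \<inter> - J_set coroot \<Lambda> = {}"
    using assms(2) w(2) multidegree_eq_0_iff by fastforce
  have "\<exists>u. set u \<subseteq> - J_set coroot \<Lambda> \<and> multidegree u = d \<and> monomial act f (w @ u) v \<noteq> 0"
    by (rule extend_monomial[OF _ _ assms(3) _ disjoint w(1)]) (use assms(4) in \<open>simp_all add: J_set_def\<close>)
  then obtain u where "multidegree u = d" "monomial act f (w @ u) v \<noteq> 0" by blast
  then show ?thesis using monomial_has_weight[of "w @ u"] w(2) by (simp add: multidegree_append)
qed

subsection \<open>The upper bound\<close>

text \<open>
  Only spanning matters for the upper bound, so the outer brackets may stand in any order to the left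
  of the \<open>f\<close>'s at \<open>J\<close>, and commutators take the place of a basis theorem for enveloping algebras.
\<close>

definition outer_brackets :: "'i set \<Rightarrow> 'g set" where
  "outer_brackets J = {monomial lie_bracket f w (f i) | w i. \<not> set (i # w) \<subseteq> J}"

lemma outer_brackets_step: "y \<in> outer_brackets J \<Longrightarrow> lie_bracket (f j) y \<in> outer_brackets J"
proof -
  assume "y \<in> outer_brackets J"
  then obtain w i where "y = monomial lie_bracket f w (f i)" "\<not> set (i # w) \<subseteq> J"
    by (auto simp: outer_brackets_def)
  then show ?thesis
    unfolding outer_brackets_def by (intro CollectI exI[of _ "j # w"] exI[of _ i]) auto
qed

inductive_set outer_words :: "'i set \<Rightarrow> 'v set" for J where
  levi: "set w \<subseteq> J \<Longrightarrow> monomial act f w v \<in> outer_words J"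
| outer: "y \<in> outer_brackets J \<Longrightarrow> x \<in> outer_words J \<Longrightarrow> act y x \<in> outer_words J"

lemma span_outer_words: "complex_vector.span (outer_words J) = UNIV" (is "?S = UNIV")
proof (rule generated_by_monomials)
  show "v \<in> ?S" using outer_words.levi[of "[]" J] by (simp add: complex_vector.span_base)
next
  fix i x assume "x \<in> ?S"
  then show "act (f i) x \<in> ?S"
  proof (rule act_span)
    fix b assume "b \<in> outer_words J"
    then show "act (f i) b \<in> ?S"
    proof induction
      case (levi w)
      show ?case
      proof (cases "i \<in> J")
        case True
        then show ?thesis using outer_words.levi[of "i # w" J] levi by (simp add: complex_vector.span_base)
      next
        case False
        then have "f i \<in> outer_brackets J"
          unfolding outer_brackets_def by (intro CollectI exI[of _ "[]"] exI[of _ i]) auto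
        then show ?thesis
          using levi by (intro complex_vector.span_base outer_words.outer outer_words.levi)
      qed
    next
      case (outer y x)
      have "act y (act (f i) x) \<in> ?S"
        using outer(1) by (intro act_span[OF outer.IH]) (auto intro: complex_vector.span_base outer_words.outer)
      moreover have "act (lie_bracket (f i) y) x \<in> ?S"
        using outer by (intro complex_vector.span_base outer_words.outer outer_brackets_step)
      ultimately show ?case by (simp add: act_commute[of "f i" y] complex_vector.span_add)
    qed
  qed simp
qed simp

lemma outer_bracket_root:
  assumes "y \<in> outer_brackets J" "y \<noteq> 0"
  shows "\<exists>\<beta>\<in>pos_roots sroot emb - pos_roots_sub sroot emb J. y \<in> weight_space emb lie_bracket (\<lambda>h. - \<beta> h)"
proof -
  obtain w i where w: "y = monomial lie_bracket f w (f i)" "\<not> set (i # w) \<subseteq> J"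
    using assms(1) by (auto simp: outer_brackets_def)
  let ?c = "multidegree w + axis i 1"
  obtain k where k: "k \<notin> J" "k \<in> set (i # w)" using w(2) by blast
  have "?c = multidegree (w @ [i])" by (simp add: multidegree_append)
  then have "?c $ k \<noteq> 0" using k(2) multidegree_eq_0_iff[of "w @ [i]" k] by auto
  then have "root_of sroot ?c \<in> pos_roots sroot emb - pos_roots_sub sroot emb J"
    using root_of_pos_root[OF bracket_e_nonzero] assms(2) w(1) k(1) pos_roots_sub_iff by blast
  then show ?thesis using bracket_f_weight w(1) by blast
qed

lemma outer_word_weight:
  assumes "x \<in> outer_words J" "x \<noteq> 0"
  shows "\<exists>\<mu> \<in> wt_sub sroot emb act \<Lambda> J. \<exists>\<phi> \<in> nat_span (pos_roots sroot emb - pos_roots_sub sroot emb J).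
    x \<in> weight_space emb act (\<lambda>h. \<mu> h - \<phi> h)"
  using assms
proof induction
  case (levi w)
  then have "(\<lambda>h. \<Lambda> h - root_of sroot (multidegree w) h) \<in> wt_sub sroot emb act \<Lambda> J"
    unfolding wt_sub_eq using monomial_has_weight multidegree_eq_0_iff by blast
  moreover have "monomial act f w v \<in>
      weight_space emb act (\<lambda>h. (\<Lambda> h - root_of sroot (multidegree w) h) - 0)"
    using monomial_v_weight[of w] by simp
  ultimately show ?case
    by (intro bexI[where x = "\<lambda>h. \<Lambda> h - root_of sroot (multidegree w) h"]
        bexI[where x = "\<lambda>h. 0"] nat_span_zero)
next
  case (outer y x)
  then have "y \<noteq> 0" "x \<noteq> 0" by auto
  then obtain \<beta> \<mu> \<phi> where \<beta>: "\<beta> \<in> pos_roots sroot emb - pos_roots_sub sroot emb J"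
      "y \<in> weight_space emb lie_bracket (\<lambda>h. - \<beta> h)"
    and \<mu>: "\<mu> \<in> wt_sub sroot emb act \<Lambda> J"
      "\<phi> \<in> nat_span (pos_roots sroot emb - pos_roots_sub sroot emb J)"
      "x \<in> weight_space emb act (\<lambda>h. \<mu> h - \<phi> h)"
    using outer_bracket_root[OF outer(1)] outer.IH by blast
  have "act y x \<in> weight_space emb act (\<lambda>h. \<mu> h - (\<beta> h + \<phi> h))"
    using weight_space_act[OF \<beta>(2) \<mu>(3)] by (simp add: algebra_simps)
  then show ?case
    by (intro bexI[where x = \<mu>] bexI[where x = "\<lambda>h. \<beta> h + \<phi> h"] \<mu>(1) nat_span_add[OF \<beta>(1) \<mu>(2)])
qed

lemma wt_subset:
  "wt emb act \<subseteq> wt_sub sroot emb act \<Lambda> J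
     \<ominus> nat_span (pos_roots sroot emb - pos_roots_sub sroot emb J)"
proof
  fix \<mu> assume "\<mu> \<in> wt emb act"
  then obtain x where x: "x \<noteq> 0" "x \<in> weight_space emb act \<mu>"
    unfolding wt_def using zero_in_weight_space by blast
  have "\<exists>b\<in>outer_words J. b \<noteq> 0 \<and> b \<in> weight_space emb act \<mu>"
  proof (rule weight_vector_in_span[OF _ x(2,1)])
    fix b assume "b \<in> outer_words J"
    then show "\<exists>\<nu>. b \<in> weight_space emb act \<nu>"
      using outer_word_weight by (cases "b = 0") auto
  qed (simp add: span_outer_words)
  then obtain b where b: "b \<in> outer_words J" "b \<noteq> 0" "b \<in> weight_space emb act \<mu>" by blast
  from outer_word_weight[OF b(1,2)] obtain \<nu> \<phi> where \<nu>: "\<nu> \<in> wt_sub sroot emb act \<Lambda> J"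
    "\<phi> \<in> nat_span (pos_roots sroot emb - pos_roots_sub sroot emb J)"
    "b \<in> weight_space emb act (\<lambda>h. \<nu> h - \<phi> h)" by blast
  then have "\<mu> = (\<lambda>h. \<nu> h - \<phi> h)" using weight_unique b by blast
  then show "\<mu> \<in> wt_sub sroot emb act \<Lambda> J
      \<ominus> nat_span (pos_roots sroot emb - pos_roots_sub sroot emb J)"
    using \<nu> by (auto intro: minkowski_diffI)
qed

subsection \<open>The weight formula\<close>

lemma wt_superset:
  assumes "\<And>c d. has_weight c \<Longrightarrow> (\<And>i. i \<notin> J \<Longrightarrow> c $ i = 0) \<Longrightarrow> (\<And>i. d $ i \<ge> 0) \<Longrightarrow>
      (\<And>i. i \<in> J \<Longrightarrow> d $ i = 0) \<Longrightarrow> has_weight (c + d)"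
  shows "wt_sub sroot emb act \<Lambda> J \<ominus> nat_span (pos_roots sroot emb - pos_roots_sub sroot emb J)
    \<subseteq> wt emb act"
proof
  fix \<mu> assume "\<mu> \<in> wt_sub sroot emb act \<Lambda> J
      \<ominus> nat_span (pos_roots sroot emb - pos_roots_sub sroot emb J)"
  then obtain \<nu> \<phi> where \<nu>: "\<nu> \<in> wt_sub sroot emb act \<Lambda> J" "\<mu> = (\<lambda>h. \<nu> h - \<phi> h)"
    and \<phi>: "\<phi> \<in> nat_span (pos_roots sroot emb - pos_roots_sub sroot emb J)"
    by (rule minkowski_diffE)
  obtain c where c: "\<nu> = (\<lambda>h. \<Lambda> h - root_of sroot c h)" "has_weight c" "\<And>i. i \<notin> J \<Longrightarrow> c $ i = 0"
    using \<nu>(1) unfolding wt_sub_eq by blast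
  obtain cs where cs: "set cs \<subseteq> level_one_degrees J" "\<phi> = root_of sroot (sum_list cs)"
    using nat_span_outside_roots[OF \<phi>] by blast
  have "has_weight (c + sum_list cs)"
    by (rule weights_minus_level_one[where J = J]) (use assms cs(1) c(2,3) in blast)+
  moreover have "\<mu> = (\<lambda>h. \<Lambda> h - root_of sroot (c + sum_list cs) h)"
    unfolding \<nu>(2) c(1) cs(2) by (auto simp: algebra_simps)
  ultimately show "\<mu> \<in> wt emb act" by (simp only: in_wt_iff)
qed

lemma simple_roots_outside:
  "nat_span (sroot ` (- J)) \<subseteq> nat_span (pos_roots sroot emb - pos_roots_sub sroot emb J)"
proof (rule nat_span_mono, rule image_subsetI)
  fix i assume i: "i \<in> - J"
  have eq: "sroot i = root_of sroot (axis i 1)" by auto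
  have "sroot i \<in> pos_roots sroot emb"
    using root_of_pos_root[of "[]" i] e_nonzero[of i] unfolding eq by simp
  moreover have "root_of sroot (axis i 1) \<notin> pos_roots_sub sroot emb J"
    using i by (auto simp: pos_roots_sub_iff simp del: root_of_axis)
  ultimately show "sroot i \<in> pos_roots sroot emb - pos_roots_sub sroot emb J"
    using eq by simp
qed

theorem weight_formula:
  "wt emb act = wt_sub sroot emb act \<Lambda> (J_set coroot \<Lambda>)
     \<ominus> nat_span (pos_roots sroot emb - pos_roots_sub sroot emb (J_set coroot \<Lambda>))"
  by (rule subset_antisym[OF wt_subset wt_superset]) (rule has_weight_outside_J_set)

theorem weight_formula_iff:
  "wt_sub sroot emb act \<Lambda> J \<ominus> nat_span (sroot ` (- J)) \<subseteq> wt emb act \<longleftrightarrow>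
     wt emb act = wt_sub sroot emb act \<Lambda> J
       \<ominus> nat_span (pos_roots sroot emb - pos_roots_sub sroot emb J)"
proof
  assume incl: "wt_sub sroot emb act \<Lambda> J \<ominus> nat_span (sroot ` (- J)) \<subseteq> wt emb act"
  have extend: "has_weight (c + d)"
    if "has_weight c" "\<And>i. i \<notin> J \<Longrightarrow> c $ i = 0" "\<And>i. d $ i \<ge> 0" "\<And>i. i \<in> J \<Longrightarrow> d $ i = 0" for c d
  proof -
    have "(\<lambda>h. \<Lambda> h - root_of sroot c h) \<in> wt_sub sroot emb act \<Lambda> J"
      unfolding wt_sub_eq using that by blast
    moreover have "root_of sroot d \<in> nat_span (sroot ` (- J))"
      unfolding nat_span_sroot using that by auto
    ultimately have "(\<lambda>h. \<Lambda> h - root_of sroot (c + d) h) \<in> wt_sub sroot emb act \<Lambda> J \<ominus> nat_span (sroot ` (- J))"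
      by (rule minkowski_diffI) simp
    then show ?thesis using incl in_wt_iff by blast
  qed
  show "wt emb act = wt_sub sroot emb act \<Lambda> J
      \<ominus> nat_span (pos_roots sroot emb - pos_roots_sub sroot emb J)"
    by (rule subset_antisym[OF wt_subset wt_superset[OF extend]])
next
  assume "wt emb act = wt_sub sroot emb act \<Lambda> J
      \<ominus> nat_span (pos_roots sroot emb - pos_roots_sub sroot emb J)"
  then show "wt_sub sroot emb act \<Lambda> J \<ominus> nat_span (sroot ` (- J)) \<subseteq> wt emb act"
    using minkowski_diff_mono[OF simple_roots_outside] by blast
qed

end

theorem theoremA:
  fixes A :: "'i::finite \<Rightarrow> 'i \<Rightarrow> int"
    and coroot :: "'i \<Rightarrow> 'h::complex_vector"
    and sroot :: "'i \<Rightarrow> 'h \<Rightarrow> complex"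
    and emb :: "'h \<Rightarrow> 'g::complex_lie_algebra"
    and e f :: "'i \<Rightarrow> 'g"
    and act :: "'g \<Rightarrow> 'v::complex_vector \<Rightarrow> 'v"
    and \<Lambda> :: "'h \<Rightarrow> complex"
    and J :: "'i set"
  assumes "kac_moody_algebra A coroot sroot emb e f"
    and "highest_weight_module emb e act \<Lambda>"
  shows "wt emb act =
           wt_sub sroot emb act \<Lambda> (J_set coroot \<Lambda>)
             \<ominus> nat_span (pos_roots sroot emb - pos_roots_sub sroot emb (J_set coroot \<Lambda>))
       \<and> (wt_sub sroot emb act \<Lambda> J \<ominus> nat_span (sroot ` (- J)) \<subseteq> wt emb act \<longleftrightarrow>
          wt emb act = wt_sub sroot emb act \<Lambda> J
             \<ominus> nat_span (pos_roots sroot emb - pos_roots_sub sroot emb J))"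
proof -
  have \<Lambda>: "\<Lambda> \<in> dual_space" and act: "lie_module act"
    using assms(2) by (simp_all add: highest_weight_module_def)
  have "\<exists>v. v \<noteq> 0 \<and> (\<forall>x\<in>n_plus e. act x v = 0) \<and>
      (\<forall>h. act (emb h) v = \<Lambda> h *\<^sub>C v) \<and> (\<forall>W. submodule act W \<longrightarrow> v \<in> W \<longrightarrow> W = UNIV)"
    using assms(2) unfolding highest_weight_module_def by (elim conjE)
  then obtain v where v: "v \<noteq> 0" "\<And>x. x \<in> n_plus e \<Longrightarrow> act x v = 0" "\<And>h. act (emb h) v = \<Lambda> h *\<^sub>C v"
    "\<And>W. submodule act W \<Longrightarrow> v \<in> W \<Longrightarrow> W = UNIV"
    by (elim exE conjE) simp
  have "act (e i) v = 0" for i by (rule v(2)) (auto simp: n_plus_def)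
  then interpret kac_moody_module A coroot sroot emb e f act \<Lambda> v
    using assms(1) \<Lambda> act v by unfold_locales (simp_all add: weight_space_def)
  show ?thesis by (intro conjI weight_formula weight_formula_iff)
qed

end
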